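(* Put $c_n:=w_{n+1}\frac{b_n}{a_n}-w_n\frac{b_{n-1}}{a_{n-1}}$ for $n\ge1$, and assume that $$\sup_{n\geq 1}\Big\{\Big|\frac{w_{n+1}a_{n+1}}{a_n}\Big|,\ |c_n|\Big\}<\infty\quad\text{and}\quad \sum_{n=1}^{\infty}\max\left\{\left|\frac{w_1b_0^2b_1\cdots b_{n-1}}{a_0a_1\cdots a_n}\right|,\ \sup_{j\ge 1}\left|\frac{c_jb_jb_{j+1}\cdots b_{j+n-1}}{a_{j+1}a_{j+2}\cdots a_{j+n}}\right|\right\}<\infty .$$ (i) If $$\sup_{n\ge1}\frac{|w_1w_2\cdots w_na_n|}{\left(1+\sum_{j=1}^\infty\left|\frac{b_nb_{n+1}\cdots b_{n+j-1}}{a_{n+1}a_{n+2}\cdots a_{n+j}}\right|^p\right)^{1/p}}=\infty,$$ then $B_w$ is hypercyclic on $\ell^p_{a,b}$, $1\le p<\infty$. (ii) If $$\sup_{n\ge1}\frac{|w_1w_2\cdots w_na_n|}{\max\left\{1,\ \sup_{j\ge1}\left|\frac{b_nb_{n+1}\cdots b_{n+j-1}}{a_{n+1}a_{n+2}\cdots a_{n+j}}\right|\right\}}=\infty,$$ then $B_w$ is hypercyclic on $c_{0,a,b}$. (iii) If $B_w$ is hypercyclic on $\ell^p_{a,b}$ (for some $1\le p<\infty$) or on $c_{0,a,b}$, then $$\sup_{n\ge1}|w_1w_2\cdots w_n|\,(|a_n|+|b_{n-1}|)=\infty.$$ (iv) Assume moreover the stronger condition $\limsup_n|b_n/a_{n+1}|<1$,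 and let $X$ be $\ell^p_{a,b}$ ($1\le p<\infty$) or $c_{0,a,b}$. Then $B_w$ is hypercyclic on $X$ if and only if $\sup_{n\ge1}|w_1w_2\cdots w_na_n|=\infty$; this is further equivalent to the existence of a bounded set $K\subset X$ such that $\bigcup_{n=0}^\infty B_w^n(K)$ is dense in $X$.
   Context: $\mathbb{D}$ is the open unit disc in $\mathbb{C}$. $a=(a_n)_{n\ge0}$ and $b=(b_n)_{n\ge0}$ are complex sequences with $a_n\ne0$ for all $n$, and $f_n(z)=(a_n+b_nz)z^n$, $n\ge0$. For $1\le p<\infty$, $\ell^p_{a,b}$ is the Banach space of analytic functions on $\mathbb{D}$ of the form $f=\sum_{n\ge0}\lambda_nf_n$ with $(\lambda_n)\in\ell^p$, normed by $\|f\|=(\sum_n|\lambda_n|^p)^{1/p}$ (so $\{f_n\}$ is a normalized Schauder basis equivalent to the standard basis of $\ell^p$, and an orthonormal basis when $p=2$). $c_{0,a,b}$ is the Banach space of analytic functions $f=\sum_{n\ge0}\lambda_nf_n$ on $\mathbb{D}$ with $\lambda_n\to0$, normed by $\|f\|=\sup_n|\lambda_n|$. Standing assumption: each of the sets $\mathcal D_1=\{z\in\mathbb{C}:\sum_n((|a_n|+|b_n|)|z|^n)^q<\infty\}$ (with $1/p+1/q=1$, relevant for $1<p<\infty$), $\mathcal D_2=\{z\in\mathbb{C}:\sup_n(|a_n|+|b_n|)|z|^n<\infty\}$ (relevant for $p=1$) and $\mathcal D_3=\{z\in\mathbb{C}:\sum_n(|a_n|+|b_n|)|z|^n<\infty\}$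 (relevant for $c_{0,a,b}$) equals $\mathbb{D}$. $w=(w_n)_{n\ge0}$ is a sequence of non-zero complex numbers, and the weighted backward shift acts on Taylor series by $B_w(\sum_{n\ge0}\lambda_nz^n)=\sum_{n\ge0}w_{n+1}\lambda_{n+1}z^n$. A bounded operator $T$ on a separable Banach space $X$ is hypercyclic if some orbit $\{x,Tx,T^2x,\dots\}$ is dense in $X$. *)

theory Defs
  imports "HOL-Complex_Analysis.Complex_Analysis"
begin

section \<open>Sequence spaces\<close>

definition lp_seqs :: "real \<Rightarrow> (nat \<Rightarrow> complex) set" where
  "lp_seqs p = {l. summable (\<lambda>n. norm (l n) powr p)}"

definition lp_seq_norm :: "real \<Rightarrow> (nat \<Rightarrow> complex) \<Rightarrow> real" where
  "lp_seq_norm p l = (\<Sum>n. norm (l n) powr p) powr (1 / p)"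

definition c0_seqs :: "(nat \<Rightarrow> complex) set" where
  "c0_seqs = {l. l \<longlonglongrightarrow> 0}"

definition c0_seq_norm :: "(nat \<Rightarrow> complex) \<Rightarrow> real" where
  "c0_seq_norm l = (SUP n. norm (l n))"


section \<open>Spaces of analytic functions with basis $f_n(z) = (a_n + b_n z) z^n$\<close>

definition basis_fun :: "(nat \<Rightarrow> complex) \<Rightarrow> (nat \<Rightarrow> complex) \<Rightarrow> nat \<Rightarrow> complex \<Rightarrow> complex" where
  "basis_fun a b n z = (a n + b n * z) * z ^ n"

definition represents ::
  "(nat \<Rightarrow> complex) \<Rightarrow> (nat \<Rightarrow> complex) \<Rightarrow> (nat \<Rightarrow> complex) \<Rightarrow> (complex \<Rightarrow> complex) \<Rightarrow> bool" where
  "represents a b l f \<longleftrightarrow> (\<forall>z\<in>ball 0 1. (\<lambda>n. l n * basis_fun a b n z) sums f z)"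

text \<open>A function on the open unit disc is encoded as a total function vanishing outside the disc,
  so that equality in HOL is equality on the disc.\<close>

definition ab_space ::
  "(nat \<Rightarrow> complex) set \<Rightarrow> (nat \<Rightarrow> complex) \<Rightarrow> (nat \<Rightarrow> complex) \<Rightarrow> (complex \<Rightarrow> complex) set" where
  "ab_space E a b = {f. f holomorphic_on ball 0 1 \<and> (\<forall>z. z \<notin> ball 0 1 \<longrightarrow> f z = 0) \<and>
                        (\<exists>l\<in>E. represents a b l f)}"

text \<open>If all \<open>a n\<close> are non-zero and the domain condition below holds, the Taylor coefficients
  \<open>l n * a n + l (n - 1) * b (n - 1)\<close> of \<open>f\<close> determine \<open>l\<close> recursively, so the description
  is proper on \<open>ab_space E a b\<close>.\<close>

definition ab_coords ::
  "(nat \<Rightarrow> complex) set \<Rightarrow> (nat \<Rightarrow> complex) \<Rightarrow> (nat \<Rightarrow> complex) \<Rightarrow> (complex \<Rightarrow> complex) \<Rightarrow> nat \<Rightarrow> complex" where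
  "ab_coords E a b f = (THE l. l \<in> E \<and> represents a b l f)"

definition lp_ab :: "real \<Rightarrow> (nat \<Rightarrow> complex) \<Rightarrow> (nat \<Rightarrow> complex) \<Rightarrow> (complex \<Rightarrow> complex) set" where
  "lp_ab p a b = ab_space (lp_seqs p) a b"

definition lp_ab_norm ::
  "real \<Rightarrow> (nat \<Rightarrow> complex) \<Rightarrow> (nat \<Rightarrow> complex) \<Rightarrow> (complex \<Rightarrow> complex) \<Rightarrow> real" where
  "lp_ab_norm p a b f = lp_seq_norm p (ab_coords (lp_seqs p) a b f)"

definition c0_ab :: "(nat \<Rightarrow> complex) \<Rightarrow> (nat \<Rightarrow> complex) \<Rightarrow> (complex \<Rightarrow> complex) set" where
  "c0_ab a b = ab_space c0_seqs a b"

definition c0_ab_norm ::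
  "(nat \<Rightarrow> complex) \<Rightarrow> (nat \<Rightarrow> complex) \<Rightarrow> (complex \<Rightarrow> complex) \<Rightarrow> real" where
  "c0_ab_norm a b f = c0_seq_norm (ab_coords c0_seqs a b f)"


section \<open>Domain conditions\<close>

definition domain1 :: "real \<Rightarrow> (nat \<Rightarrow> complex) \<Rightarrow> (nat \<Rightarrow> complex) \<Rightarrow> complex set" where
  "domain1 q a b = {z. summable (\<lambda>n. ((norm (a n) + norm (b n)) * norm z ^ n) powr q)}"

definition domain2 :: "(nat \<Rightarrow> complex) \<Rightarrow> (nat \<Rightarrow> complex) \<Rightarrow> complex set" where
  "domain2 a b = {z. bdd_above (range (\<lambda>n. (norm (a n) + norm (b n)) * norm z ^ n))}"

definition domain3 :: "(nat \<Rightarrow> complex) \<Rightarrow> (nat \<Rightarrow> complex) \<Rightarrow> complex set" where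
  "domain3 a b = {z. summable (\<lambda>n. (norm (a n) + norm (b n)) * norm z ^ n)}"

text \<open>Each space carries only the domain condition relevant to it. Requiring all of them at once
  would exclude, for example, the Hardy space \<open>H\<^sup>2\<close> (\<open>p = 2\<close>, \<open>a n = 1\<close>, \<open>b n = 0\<close>),
  for which \<open>domain2 a b\<close> is the closed disc.\<close>

definition lp_domain_cond :: "real \<Rightarrow> (nat \<Rightarrow> complex) \<Rightarrow> (nat \<Rightarrow> complex) \<Rightarrow> bool" where
  "lp_domain_cond p a b \<longleftrightarrow>
     (if p = 1 then domain2 a b = ball 0 1
      else (\<forall>q. 1 / p + 1 / q = 1 \<longrightarrow> domain1 q a b = ball 0 1))"

definition c0_domain_cond :: "(nat \<Rightarrow> complex) \<Rightarrow> (nat \<Rightarrow> complex) \<Rightarrow> bool" where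
  "c0_domain_cond a b \<longleftrightarrow> domain3 a b = ball 0 1"


section \<open>The weighted backward shift and hypercyclicity\<close>

definition backward_shift :: "(nat \<Rightarrow> complex) \<Rightarrow> (complex \<Rightarrow> complex) \<Rightarrow> complex \<Rightarrow> complex" where
  "backward_shift w f = (\<lambda>z. if z \<in> ball 0 1
     then eval_fps (Abs_fps (\<lambda>n. w (n + 1) * fps_nth (fps_expansion f 0) (n + 1))) z else 0)"

text \<open>In the following, \<open>X\<close> is the carrier of a normed space of functions and \<open>N\<close> its norm.\<close>

definition bounded_operator_on ::
  "(complex \<Rightarrow> complex) set \<Rightarrow> ((complex \<Rightarrow> complex) \<Rightarrow> real) \<Rightarrow>
   ((complex \<Rightarrow> complex) \<Rightarrow> complex \<Rightarrow> complex) \<Rightarrow> bool" where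
  "bounded_operator_on X N T \<longleftrightarrow>
     (\<forall>f\<in>X. T f \<in> X) \<and>
     (\<forall>f\<in>X. \<forall>g\<in>X. T (\<lambda>z. f z + g z) = (\<lambda>z. T f z + T g z)) \<and>
     (\<forall>k. \<forall>f\<in>X. T (\<lambda>z. k * f z) = (\<lambda>z. k * T f z)) \<and>
     (\<exists>C. \<forall>f\<in>X. N (T f) \<le> C * N f)"

definition norm_dense_in ::
  "(complex \<Rightarrow> complex) set \<Rightarrow> ((complex \<Rightarrow> complex) \<Rightarrow> real) \<Rightarrow> (complex \<Rightarrow> complex) set \<Rightarrow> bool" where
  "norm_dense_in X N S \<longleftrightarrow> S \<subseteq> X \<and> (\<forall>f\<in>X. \<forall>e>0. \<exists>g\<in>S. N (\<lambda>z. f z - g z) < e)"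

definition norm_bounded_in ::
  "(complex \<Rightarrow> complex) set \<Rightarrow> ((complex \<Rightarrow> complex) \<Rightarrow> real) \<Rightarrow> (complex \<Rightarrow> complex) set \<Rightarrow> bool" where
  "norm_bounded_in X N K \<longleftrightarrow> K \<subseteq> X \<and> (\<exists>C. \<forall>f\<in>K. N f \<le> C)"

definition hypercyclic_on ::
  "(complex \<Rightarrow> complex) set \<Rightarrow> ((complex \<Rightarrow> complex) \<Rightarrow> real) \<Rightarrow>
   ((complex \<Rightarrow> complex) \<Rightarrow> complex \<Rightarrow> complex) \<Rightarrow> bool" where
  "hypercyclic_on X N T \<longleftrightarrow>
     bounded_operator_on X N T \<and> (\<exists>f\<in>X. norm_dense_in X N (range (\<lambda>n. (T ^^ n) f)))"


section \<open>Coefficients in the hypotheses\<close>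

text \<open>Only used for \<open>n \<ge> 1\<close>.\<close>

definition shift_coeff ::
  "(nat \<Rightarrow> complex) \<Rightarrow> (nat \<Rightarrow> complex) \<Rightarrow> (nat \<Rightarrow> complex) \<Rightarrow> nat \<Rightarrow> complex" where
  "shift_coeff a b w n = w (n + 1) * (b n / a n) - w n * (b (n - 1) / a (n - 1))"

text \<open>$b_n b_{n+1} \cdots b_{n+j-1} / (a_{n+1} a_{n+2} \cdots a_{n+j})$; up to sign this is the
  coefficient of $f_{n+j}$ in the formal expansion of $a_n z^n$.\<close>

definition ratio_prod :: "(nat \<Rightarrow> complex) \<Rightarrow> (nat \<Rightarrow> complex) \<Rightarrow> nat \<Rightarrow> nat \<Rightarrow> complex" where
  "ratio_prod a b n j = (\<Prod>k=n..<n+j. b k) / (\<Prod>k=n+1..n+j. a k)"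

text \<open>Real power of an extended non-negative number, for exponents \<open>r > 0\<close>.\<close>

definition ennreal_powr :: "ennreal \<Rightarrow> real \<Rightarrow> ennreal" where
  "ennreal_powr x r = (if x = \<infinity> then \<infinity> else ennreal (enn2real x powr r))"

end

(* In coordinates with respect to the basis f_n, the operator B_w is a lower Hessenberg matrix whose
   diagonals have summable suprema, hence bounded.  The hypotheses moreover force the ratios
   b_n...b_{n+j-1}/(a_{n+1}...a_{n+j}) to be summable in j, so every monomial z^n lies in the space,
   with norm given by the denominators in (i) and (ii).  Since B_w maps z^{n+1}/(w_1...w_{n+1}) to
   z^n/(w_1...w_n), small norms of these vectors along a subsequence give, after applying powers of
   the bounded operator B_w, small preimages of all polynomials under high powers of B_w, and a
   hypercyclic vector is a series of such preimages.
   Conversely, the value of B_w^n f at 0 is w_1...w_n times the n-th Taylor coefficient of f; it stays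
   bounded for f in a bounded set if the supremum in (iii) is finite. *)

theory Submission
  imports Defs
begin

section \<open>Banach sequence spaces\<close>

text \<open>The two kinds of spaces enter only through solidity, contractive shifts, vanishing tails
  and completeness, so the argument runs once, on coordinate sequences. The matrix is in general
  full below its diagonal, and its powers have no convenient closed form in coordinates. Work is
  therefore divided between two pictures: norms are estimated in coordinates, while iterates of
  monomials and polynomials are computed on Taylor coefficients, where the operator is a plain
  weighted shift. The passage between the two is a bidiagonal map, injective because all
  \<open>a n\<close> are non-zero.

  An unbounded supremum supplies only isolated good indices, whereas a polynomial of degree K needs
  K+1 consecutive small monomials. The descent from a good index costs at most the factor
  \<open>op_bound ^ K\<close>, which is fixed before the index is chosen. In the explicit series for
  the hypercyclic vector, every summand added after exponent n carries the factor 1 /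
  \<open>op_bound ^ n\<close>, so that it cannot spoil the approximation reached at time n.\<close>

lemma powr_convex_combination:
  fixes x y u v p :: real
  assumes "p \<ge> 1" "x \<ge> 0" "y \<ge> 0" "u \<ge> 0" "v \<ge> 0" "u + v = 1"
  shows "(u * x + v * y) powr p \<le> u * x powr p + v * y powr p"
proof -
  \<comment> \<open>Settles the case of a zero argument through t powr p \<le> t on [0,1]; convexity
    is applied to positive arguments only.\<close>
  have scale: "(t * s) powr p \<le> t * s powr p" if "t \<ge> 0" "t \<le> 1" "s \<ge> 0" for t s :: real
  proof -
    have "t powr p \<le> t powr 1"
      using that assms(1) powr_mono'[of 1 p t] by (cases "t = 0") auto
    then have "t powr p * s powr p \<le> t * s powr p"
      using that by (intro mult_right_mono) auto
    then show ?thesis using that by (simp add: powr_mult)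
  qed
  have uv: "u \<le> 1" "v \<le> 1" using assms by auto
  show ?thesis
  proof (cases "x = 0 \<or> y = 0")
    case True
    then show ?thesis using scale[of u x] scale[of v y] uv assms by auto
  next
    case False
    then have "x > 0" "y > 0" using assms by auto
    then show ?thesis
      using powr_convex[OF assms(1)] assms unfolding convex_on_def by fastforce
  qed
qed

section \<open>Abstract solid Banach sequence spaces\<close>

text \<open>The common features of l^p and c_0. \<open>tail\<close> excludes spaces such as
  l^infinity and is the source of separability. \<open>complete\<close> takes a Cauchy modulus
  \<open>d\<close> together with a candidate limit and returns the same modulus as rate of
  convergence, so limits come with explicit norm bounds.\<close>

locale seq_space =
  fixes E :: "(nat \<Rightarrow> complex) set" and N :: "(nat \<Rightarrow> complex) \<Rightarrow> real"
  assumes unit: "(\<lambda>n. if n = k then 1 else 0) \<in> E" "N (\<lambda>n. if n = k then 1 else 0) \<le> 1"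
    and solid: "x \<in> E \<Longrightarrow> (\<And>n. norm (y n) \<le> norm (x n)) \<Longrightarrow> y \<in> E \<and> N y \<le> N x"
    and add: "x \<in> E \<Longrightarrow> y \<in> E \<Longrightarrow> (\<lambda>n. x n + y n) \<in> E \<and> N (\<lambda>n. x n + y n) \<le> N x + N y"
    and scale: "x \<in> E \<Longrightarrow> (\<lambda>n. c * x n) \<in> E \<and> N (\<lambda>n. c * x n) \<le> norm c * N x"
    and coord: "x \<in> E \<Longrightarrow> norm (x n) \<le> N x"
    and left_shift: "x \<in> E \<Longrightarrow> (\<lambda>n. x (Suc n)) \<in> E \<and> N (\<lambda>n. x (Suc n)) \<le> N x"
    and right_shift: "x \<in> E \<Longrightarrow> (\<lambda>n. if n < k then 0 else x (n - k)) \<in> E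
                        \<and> N (\<lambda>n. if n < k then 0 else x (n - k)) \<le> N x"
    and tail: "x \<in> E \<Longrightarrow> (\<lambda>K. N (\<lambda>n. if n < K then 0 else x n)) \<longlonglongrightarrow> 0"
    and complete: "(\<And>k. X k \<in> E) \<Longrightarrow> (\<And>k l. k \<le> l \<Longrightarrow> N (\<lambda>n. X l n - X k n) \<le> d k) \<Longrightarrow>
       d \<longlonglongrightarrow> 0 \<Longrightarrow> (\<And>n. (\<lambda>k. X k n) \<longlonglongrightarrow> z n) \<Longrightarrow> z \<in> E \<and> (\<forall>k. N (\<lambda>n. z n - X k n) \<le> d k)"
begin

lemma zero: "(\<lambda>_. 0) \<in> E" "N (\<lambda>_. 0) = 0"
proof -
  have z: "(\<lambda>_. 0) \<in> E \<and> N (\<lambda>_. 0) \<le> 0"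
    using scale[OF unit(1)[of 0], of 0] by simp
  then show "(\<lambda>_. 0) \<in> E" ..
  show "N (\<lambda>_. 0) = 0" using z coord[of "\<lambda>_. 0" 0] by auto
qed

lemma N_nonneg: "x \<in> E \<Longrightarrow> N x \<ge> 0"
  using coord[of x 0] norm_ge_zero[of "x 0"] by linarith

lemma diff: "x \<in> E \<Longrightarrow> y \<in> E \<Longrightarrow> (\<lambda>n. x n - y n) \<in> E \<and> N (\<lambda>n. x n - y n) \<le> N x + N y"
  using add[of x "\<lambda>n. - y n"] solid[of y "\<lambda>n. - y n"] by force

lemma diff_commute: "x \<in> E \<Longrightarrow> y \<in> E \<Longrightarrow> N (\<lambda>n. x n - y n) = N (\<lambda>n. y n - x n)"
  using solid[of "\<lambda>n. x n - y n" "\<lambda>n. y n - x n"] solid[of "\<lambda>n. y n - x n" "\<lambda>n. x n - y n"]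
    diff[of x y] diff[of y x] by (force simp: norm_minus_commute)

lemma diff_triangle:
  assumes "x \<in> E" "y \<in> E" "z \<in> E"
  shows "N (\<lambda>n. x n - z n) \<le> N (\<lambda>n. x n - y n) + N (\<lambda>n. y n - z n)"
  using add[of "\<lambda>n. x n - y n" "\<lambda>n. y n - z n"] assms diff by simp

lemma sum_closed:
  assumes "finite I" "\<And>i. i \<in> I \<Longrightarrow> x i \<in> E"
  shows "(\<lambda>n. \<Sum>i\<in>I. x i n) \<in> E \<and> N (\<lambda>n. \<Sum>i\<in>I. x i n) \<le> (\<Sum>i\<in>I. N (x i))"
  using assms
proof (induction I rule: finite_induct)
  case empty
  then show ?case using zero by simp
next
  case (insert i I)
  then show ?case using add[of "x i" "\<lambda>n. \<Sum>i\<in>I. x i n"] by fastforce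
qed

text \<open>Young's inequality with an l^1 kernel: right shifts are contractions, so the series of
  the shifts of |x| with weights \<alpha> n converges absolutely in norm. Its sum, together with the
  left-shifted term, dominates \<open>y\<close>, and solidity transfers the bound.\<close>

lemma convolution_bound:
  assumes x: "x \<in> E" and \<alpha>: "summable \<alpha>" "\<And>n. \<alpha> n \<ge> 0" and M: "M \<ge> 0"
    and y: "\<And>m. norm (y m) \<le> M * norm (x (Suc m)) + (\<Sum>n\<le>m. \<alpha> n * norm (x (m - n)))"
  shows "y \<in> E \<and> N y \<le> (M + (\<Sum>n. \<alpha> n)) * N x"
proof -
  \<comment> \<open>Passing to moduli makes the dominating sequence \<open>z\<close> non-negative,
    so that its modulus is literally the right-hand side of the assumption on
    \<open>y\<close>.\<close>
  define x' where "x' = (\<lambda>n. complex_of_real (norm (x n)))"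
  define u where "u n = (\<lambda>m. complex_of_real (\<alpha> n) * (if m < n then 0 else x' (m - n)))" for n
  define d where "d R = (\<Sum>n. \<alpha> (n + R)) * N x" for R
  define h where "h = (\<lambda>m. complex_of_real M * x' (Suc m))"
  define g where "g R = (\<lambda>m. h m + (\<Sum>n<R. u n m))" for R
  \<comment> \<open>In coordinate m every \<open>u n\<close> with n > m vanishes, so the partial
    sums are constant from index \<open>Suc m\<close> on.\<close>
  define z where "z = (\<lambda>m. g (Suc m) m)"
  have x': "x' \<in> E" "N x' \<le> N x" using solid[OF x, of x'] by (auto simp: x'_def)
  have u: "u n \<in> E" "N (u n) \<le> \<alpha> n * N x" for n
  proof -
    note r = right_shift[OF x'(1), of n]
    have "u n \<in> E \<and> N (u n) \<le> norm (complex_of_real (\<alpha> n)) * N (\<lambda>m. if m < n then 0 else x' (m - n))"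
      unfolding u_def by (rule scale) (use r in auto)
    moreover have "\<alpha> n * N (\<lambda>m. if m < n then 0 else x' (m - n)) \<le> \<alpha> n * N x"
      by (rule mult_left_mono) (use r x' \<alpha> in auto)
    ultimately show "u n \<in> E" "N (u n) \<le> \<alpha> n * N x" using \<alpha>(2)[of n] by auto
  qed
  have h: "h \<in> E" "N h \<le> M * N x"
  proof -
    have "h \<in> E \<and> N h \<le> norm (complex_of_real M) * N (\<lambda>m. x' (Suc m))"
      unfolding h_def by (rule scale) (use left_shift x' in auto)
    moreover have "M * N (\<lambda>m. x' (Suc m)) \<le> M * N x"
      by (rule mult_left_mono) (use left_shift[of x'] x' M in auto)
    ultimately show "h \<in> E" "N h \<le> M * N x" using M by auto
  qed
  have g: "g R \<in> E" for R
    unfolding g_def using add h sum_closed[of "{..<R}" u] u by auto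
  have gd: "N (\<lambda>m. g L m - g R m) \<le> d R" if "R \<le> L" for R L
  proof -
    have eq: "g L m - g R m = (\<Sum>n\<in>{R..<L}. u n m)" for m
      using that by (simp add: g_def lessThan_atLeast0 sum_diff_nat_ivl)
    have "N (\<lambda>m. g L m - g R m) \<le> (\<Sum>n\<in>{R..<L}. N (u n))"
      unfolding eq using sum_closed[of "{R..<L}" u] u by auto
    also have "\<dots> \<le> (\<Sum>n\<in>{R..<L}. \<alpha> n * N x)" by (intro sum_mono u)
    also have "\<dots> = (\<Sum>n\<in>{R..<L}. \<alpha> n) * N x" by (simp add: sum_distrib_right)
    also have "(\<Sum>n\<in>{R..<L}. \<alpha> n) = (\<Sum>n\<in>{..<L-R}. \<alpha> (n + R))"
      using sum.shift_bounds_nat_ivl[of \<alpha> 0 R "L - R"] that by (simp add: lessThan_atLeast0)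
    also have "\<dots> * N x \<le> d R"
      unfolding d_def
      by (intro mult_right_mono sum_le_suminf N_nonneg x) (use \<alpha> in \<open>auto simp: summable_iff_shift\<close>)
    finally show ?thesis .
  qed
  have d0: "d \<longlonglongrightarrow> 0"
    unfolding d_def using tendsto_mult_left_zero[OF suminf_exist_split2[OF \<alpha>(1)]] by simp
  have ptw: "(\<lambda>R. g R m) \<longlonglongrightarrow> z m" for m
  proof (rule tendsto_eventually)
    have "g R m = z m" if "R \<ge> Suc m" for R
    proof -
      have "(\<Sum>n<R. u n m) = (\<Sum>n<Suc m. u n m)"
        using that by (intro sum.mono_neutral_right) (auto simp: u_def)
      then show ?thesis by (simp add: g_def z_def)
    qed
    then show "\<forall>\<^sub>F R in sequentially. g R m = z m" using eventually_sequentially by blast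
  qed
  have z: "z \<in> E" "N (\<lambda>m. z m - g 0 m) \<le> d 0"
    using complete[of g d z, OF g gd d0 ptw] by auto
  have "N z \<le> N (\<lambda>m. z m - g 0 m) + N (g 0)"
    using add[of "\<lambda>m. z m - g 0 m" "g 0"] diff[OF z(1) g] g by auto
  also have "\<dots> \<le> d 0 + M * N x" using z h by (simp add: g_def)
  finally have Nz: "N z \<le> (M + (\<Sum>n. \<alpha> n)) * N x" by (simp add: d_def algebra_simps)
  have "norm (y m) \<le> norm (z m)" for m
  proof -
    have "z m = complex_of_real (M * norm (x (Suc m)) + (\<Sum>n\<le>m. \<alpha> n * norm (x (m - n))))"
      unfolding z_def g_def h_def x'_def u_def lessThan_Suc_atMost by simp
    also have "norm \<dots> = M * norm (x (Suc m)) + (\<Sum>n\<le>m. \<alpha> n * norm (x (m - n)))"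
      unfolding norm_of_real by (rule abs_of_nonneg) (intro add_nonneg_nonneg sum_nonneg mult_nonneg_nonneg M \<alpha> norm_ge_zero)
    finally show ?thesis using y by simp
  qed
  then show ?thesis using solid[OF z(1), of y] Nz by fastforce
qed

text \<open>The sequence is dominated by the convolution of its own moduli with the unit vector at
  0; hence l^1 is contained in every such space.\<close>

lemma summable_in_space:
  assumes "summable (\<lambda>n. norm (y n))"
  shows "y \<in> E"
proof -
  let ?x = "\<lambda>n. if n = 0 then 1 else 0 :: complex"
  have "y \<in> E \<and> N y \<le> (0 + (\<Sum>n. norm (y n))) * N ?x"
  proof (rule convolution_bound[OF unit(1) assms])
    fix m
    have "norm (y m) = (\<Sum>n\<in>{m}. norm (y n) * norm (?x (m - n)))" by simp
    also have "\<dots> \<le> (\<Sum>n\<le>m. norm (y n) * norm (?x (m - n)))" by (rule sum_mono2) auto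
    finally show "norm (y m) \<le> 0 * norm (?x (Suc m)) + (\<Sum>n\<le>m. norm (y n) * norm (?x (m - n)))"
      by simp
  qed auto
  then show ?thesis ..
qed

lemma cauchy_limit:
  assumes X: "\<And>k. X k \<in> E" and step: "\<And>k. N (\<lambda>n. X (Suc k) n - X k n) \<le> (1/2)^k"
  obtains z where "z \<in> E" "\<And>k. N (\<lambda>n. z n - X k n) \<le> 2 * (1/2)^k"
proof -
  \<comment> \<open>The subtracted term is what remains of the full geometric series; keeping it
    makes the induction close exactly.\<close>
  have tele: "N (\<lambda>n. X (k + j) n - X k n) \<le> 2 * (1/2)^k - 2 * (1/2)^(k+j)" for k j
  proof (induction j)
    case 0
    then show ?case using zero by simp
  next
    case (Suc j)
    have "N (\<lambda>n. X (k + Suc j) n - X k n) \<le> N (\<lambda>n. X (Suc (k + j)) n - X (k+j) n) + N (\<lambda>n. X (k+j) n - X k n)"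
      using diff_triangle[OF X X X] by simp
    also have "\<dots> \<le> (1/2)^(k+j) + (2 * (1/2)^k - 2 * (1/2)^(k+j))" using Suc step by (intro add_mono)
    finally show ?case by simp
  qed
  have bd: "N (\<lambda>n. X l n - X k n) \<le> 2 * (1/2)^k" if "k \<le> l" for k l
  proof -
    have "N (\<lambda>n. X l n - X k n) \<le> 2 * (1/2)^k - 2 * (1/2)^l" using tele[of k "l - k"] that by simp
    moreover have "(0::real) \<le> 2 * (1/2)^l" by simp
    ultimately show ?thesis by linarith
  qed
  have lim0: "(\<lambda>k. 2 * (1/2::real)^k) \<longlonglongrightarrow> 0"
    using tendsto_mult_right_zero[OF LIMSEQ_power_zero[of "1/2::real"]] by simp
  have "Cauchy (\<lambda>k. X k n)" for n
  proof (rule metric_CauchyI)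
    fix e :: real assume "e > 0"
    then have "\<forall>\<^sub>F k in sequentially. 2 * (1/2::real)^k < e/2"
      using order_tendstoD(2)[OF lim0, of "e/2"] by simp
    then obtain K where K: "2 * (1/2::real)^K < e/2" by (auto simp: eventually_sequentially)
    have cl: "dist (X k n) (X K n) < e/2" if "k \<ge> K" for k
      using coord[of "\<lambda>n. X k n - X K n" n] diff[OF X X] bd[OF that] K
      unfolding dist_norm by fastforce
    have "dist (X k n) (X l n) < e" if "k \<ge> K" "l \<ge> K" for k l
      using cl[OF that(1)] cl[OF that(2)] dist_triangle_half_l by blast
    then show "\<exists>M. \<forall>m\<ge>M. \<forall>n'\<ge>M. dist (X m n) (X n' n) < e" by blast
  qed
  then have "\<exists>z. \<forall>n. (\<lambda>k. X k n) \<longlonglongrightarrow> z n"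
    by (intro choice) (auto simp: Cauchy_convergent_iff convergent_def)
  then obtain z where z: "\<And>n. (\<lambda>k. X k n) \<longlonglongrightarrow> z n" by blast
  then show ?thesis using complete[of X "\<lambda>k. 2 * (1/2)^k" z, OF X bd lim0 z] that by blast
qed

text \<open>The dense family consists of lists over a countable dense subset of the complex numbers,
  extended by zero. Finite support matters later: these targets are polynomials.\<close>

lemma countable_dense:
  "\<exists>y :: nat \<Rightarrow> nat \<Rightarrow> complex. (\<forall>i. \<exists>K. \<forall>n\<ge>K. y i n = 0) \<and>
       (\<forall>x\<in>E. \<forall>e>0. \<exists>i. y i \<in> E \<and> N (\<lambda>n. x n - y i n) < e)"
proof -
  obtain D :: "complex set" where D: "countable D" "\<And>X. open X \<Longrightarrow> X \<noteq> {} \<Longrightarrow> \<exists>d\<in>D. d \<in> X"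
    using countable_dense_setE by blast
  define q where "q l = (\<lambda>n. if n < length l then l ! n else (0::complex))" for l
  have ne: "lists D \<noteq> {}" by blast
  have cl: "countable (lists D)" using D by simp
  define y where "y i = q (from_nat_into (lists D) i)" for i
  show ?thesis
  proof (intro exI[of _ y] conjI allI ballI impI)
    show "\<exists>K. \<forall>n\<ge>K. y i n = 0" for i
      by (rule exI[of _ "length (from_nat_into (lists D) i)"]) (simp add: y_def q_def)
  next
    fix x e assume x: "x \<in> E" and e: "(e::real) > 0"
    have "\<forall>\<^sub>F K in sequentially. N (\<lambda>n. if n < K then 0 else x n) < e/2"
      using order_tendstoD(2)[OF tail[OF x], of "e/2"] e by simp
    then obtain K where K: "N (\<lambda>n. if n < K then 0 else x n) < e/2"
      by (auto simp: eventually_sequentially)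
    \<comment> \<open>Half of \<open>e\<close> is spent on the tail beyond K, the other half on K
      coordinates with error at most \<delta> each; the added 1 covers K = 0.\<close>
    define \<delta> where "\<delta> = e / (2 * (real K + 1))"
    have \<delta>: "\<delta> > 0" using e by (simp add: \<delta>_def)
    have "\<exists>d\<in>D. d \<in> ball (x n) \<delta>" for n using D(2)[of "ball (x n) \<delta>"] \<delta> by auto
    then obtain c where c: "\<And>n. c n \<in> D" "\<And>n. c n \<in> ball (x n) \<delta>" by metis
    define l where "l = map c [0..<K]"
    have l: "l \<in> lists D" using c by (auto simp: l_def)
    then obtain i where i: "from_nat_into (lists D) i = l"
      using from_nat_into_surj[OF cl] by blast
    have yi: "y i n = (if n < K then c n else 0)" for n by (auto simp: y_def i q_def l_def)
    define r where "r k = (\<lambda>n. (x k - c k) * (if n = k then 1 else 0))" for k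
    have r: "r k \<in> E \<and> N (r k) \<le> \<delta>" for k
    proof -
      have "r k \<in> E \<and> N (r k) \<le> norm (x k - c k) * N (\<lambda>n. if n = k then 1 else 0)"
        unfolding r_def by (rule scale[OF unit(1)])
      moreover have "norm (x k - c k) * N (\<lambda>n. if n = k then 1 else 0) \<le> \<delta> * 1"
        using c(2)[of k] \<delta> unit[of k] N_nonneg[OF unit(1), of k] by (intro mult_mono) (auto simp: dist_norm)
      ultimately show ?thesis by auto
    qed
    have tl: "(\<lambda>n. if n < K then 0 else x n) \<in> E"
      using solid[OF x, of "\<lambda>n. if n < K then 0 else x n"] by auto
    have eq: "x n - y i n = (\<Sum>k<K. r k n) + (if n < K then 0 else x n)" for n
      by (auto simp: yi r_def if_distrib[of "\<lambda>t. _ * t"] cong: if_cong)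
    have sc: "(\<lambda>n. \<Sum>k<K. r k n) \<in> E" "N (\<lambda>n. \<Sum>k<K. r k n) \<le> (\<Sum>k<K. N (r k))"
      using sum_closed[of "{..<K}" r] r by auto
    have "(\<Sum>k<K. N (r k)) \<le> (\<Sum>k<K. \<delta>)" by (intro sum_mono) (use r in auto)
    also have "\<dots> \<le> e/2" using e by (simp add: \<delta>_def field_simps)
    finally have s: "(\<Sum>k<K. N (r k)) \<le> e/2" .
    have a: "(\<lambda>n. x n - y i n) \<in> E" "N (\<lambda>n. x n - y i n) < e"
      unfolding eq using add[OF sc(1) tl] sc(2) s K by auto
    have "y i = (\<lambda>n. x n - (x n - y i n))" by simp
    then have "y i \<in> E" using diff[OF x a(1)] by simp
    then show "\<exists>i. y i \<in> E \<and> N (\<lambda>n. x n - y i n) < e" using a by blast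
  qed
qed

end

section \<open>The spaces l^p\<close>

lemma lp_seq_norm_nonneg: "lp_seq_norm p x \<ge> 0"
  by (simp add: lp_seq_norm_def)

lemma lp_seq_norm_powr:
  assumes "p \<ge> 1" "x \<in> lp_seqs p"
  shows "lp_seq_norm p x powr p = (\<Sum>n. norm (x n) powr p)"
proof -
  have "(\<Sum>n. norm (x n) powr p) \<ge> 0" using assms by (intro suminf_nonneg) (auto simp: lp_seqs_def)
  then show ?thesis using assms by (simp add: lp_seq_norm_def powr_powr)
qed

text \<open>Membership and norm bound follow together from bounds on finite sums, which spares
  separate summability arguments in the verifications below.\<close>

lemma lp_seqsI_partial_sums:
  assumes p: "p \<ge> 1" and C: "C \<ge> 0" and le: "\<And>M. (\<Sum>n<M. norm (x n) powr p) \<le> C powr p"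
  shows "x \<in> lp_seqs p \<and> lp_seq_norm p x \<le> C"
proof -
  have s: "summable (\<lambda>n. norm (x n) powr p)"
    by (rule summableI_nonneg_bounded) (use le in auto)
  have "(\<Sum>n. norm (x n) powr p) \<le> C powr p" by (rule suminf_le_const[OF s le])
  moreover have "(\<Sum>n. norm (x n) powr p) \<ge> 0" by (intro suminf_nonneg s) auto
  ultimately have "lp_seq_norm p x \<le> (C powr p) powr (1/p)"
    unfolding lp_seq_norm_def using p by (intro powr_mono2) auto
  then show ?thesis using s p C by (simp add: lp_seqs_def powr_powr)
qed

lemma lp_partial_sums_le:
  assumes p: "p \<ge> 1" and x: "x \<in> lp_seqs p"
  shows "(\<Sum>n<M. norm (x n) powr p) \<le> lp_seq_norm p x powr p"
  unfolding lp_seq_norm_powr[OF assms]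
  by (rule sum_le_suminf) (use x in \<open>auto simp: lp_seqs_def\<close>)

lemma lp_coord_le:
  assumes p: "p \<ge> 1" and x: "x \<in> lp_seqs p"
  shows "norm (x n) \<le> lp_seq_norm p x"
proof -
  have "norm (x n) powr p = (\<Sum>n\<in>{n}. norm (x n) powr p)" by simp
  also have "\<dots> \<le> (\<Sum>n<Suc n. norm (x n) powr p)" by (rule sum_mono2) auto
  also have "\<dots> \<le> lp_seq_norm p x powr p" by (rule lp_partial_sums_le[OF assms])
  finally show ?thesis using p lp_seq_norm_nonneg[of p x]
    by (smt (verit) powr_less_mono2 norm_ge_zero)
qed

text \<open>Minkowski's inequality by normalisation. For norms s, t > 0 and r = s + t, the quotient
  |x n + y n| / r is at most the convex combination of |x n| / s and |y n| / t with weights s/r and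
  t/r; convexity of the p-th power is then summed over n. A sequence of norm zero vanishes and is
  treated apart.\<close>

lemma lp_triangle:
  assumes p: "p \<ge> 1" and x: "x \<in> lp_seqs p" and y: "y \<in> lp_seqs p"
  shows "(\<lambda>n. x n + y n) \<in> lp_seqs p \<and> lp_seq_norm p (\<lambda>n. x n + y n) \<le> lp_seq_norm p x + lp_seq_norm p y"
proof (rule lp_seqsI_partial_sums[OF p])
  let ?s = "lp_seq_norm p x" and ?t = "lp_seq_norm p y"
  show nn: "?s + ?t \<ge> 0" using lp_seq_norm_nonneg[of p x] lp_seq_norm_nonneg[of p y] by simp
  fix M
  consider "?s = 0" | "?t = 0" | "?s > 0" "?t > 0"
    using lp_seq_norm_nonneg[of p x] lp_seq_norm_nonneg[of p y] by linarith
  then show "(\<Sum>n<M. norm (x n + y n) powr p) \<le> (?s + ?t) powr p"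
  proof cases
    case 1
    then have "x n = 0" for n using lp_coord_le[OF p x, of n] by simp
    then show ?thesis using 1 lp_partial_sums_le[OF p y] by simp
  next
    case 2
    then have "y n = 0" for n using lp_coord_le[OF p y, of n] by simp
    then show ?thesis using 2 lp_partial_sums_le[OF p x] by simp
  next
    case 3
    let ?r = "?s + ?t"
    have termwise: "norm (x n + y n) powr p \<le>
        ?r powr p * (?s/?r * (norm (x n) powr p / ?s powr p) + ?t/?r * (norm (y n) powr p / ?t powr p))" for n
    proof -
      have "?r * (?s/?r * (norm (x n) / ?s) + ?t/?r * (norm (y n) / ?t)) = norm (x n) + norm (y n)"
        using 3 by (simp add: distrib_left del: distrib_left_numeral)
      then have "norm (x n + y n) powr p \<le> (?r * (?s/?r * (norm (x n) / ?s) + ?t/?r * (norm (y n) / ?t))) powr p"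
        using 3 p norm_triangle_ineq[of "x n" "y n"] by (intro powr_mono2) auto
      also have "\<dots> = ?r powr p * (?s/?r * (norm (x n) / ?s) + ?t/?r * (norm (y n) / ?t)) powr p"
        using 3 by (intro powr_mult)
      also have "\<dots> \<le> ?r powr p * (?s/?r * (norm (x n) / ?s) powr p + ?t/?r * (norm (y n) / ?t) powr p)"
        using 3 p by (intro mult_left_mono powr_convex_combination) (auto simp: add_divide_distrib[symmetric])
      finally show ?thesis using 3 by (simp add: powr_divide)
    qed
    have "(\<Sum>n<M. norm (x n + y n) powr p) \<le> (\<Sum>n<M. ?r powr p * (?s/?r * (norm (x n) powr p / ?s powr p) + ?t/?r * (norm (y n) powr p / ?t powr p)))"
      by (intro sum_mono termwise)
    also have "\<dots> = ?r powr p * (?s/?r * ((\<Sum>n<M. norm (x n) powr p) / ?s powr p) + ?t/?r * ((\<Sum>n<M. norm (y n) powr p) / ?t powr p))"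
      by (simp only: sum_divide_distrib sum_distrib_left sum.distrib[symmetric])
    also have "\<dots> \<le> ?r powr p * (?s/?r * 1 + ?t/?r * 1)"
      using 3 lp_partial_sums_le[OF p x, of M] lp_partial_sums_le[OF p y, of M]
      by (intro mult_left_mono add_mono) auto
    also have "\<dots> = ?r powr p" using 3 by (simp add: add_divide_distrib[symmetric])
    finally show ?thesis .
  qed
qed

text \<open>Lower semicontinuity of the norm under coordinatewise convergence, since finite sums
  pass to the limit. Applied to differences it yields completeness with the required rate.\<close>

lemma lp_fatou:
  assumes p: "p \<ge> 1" and X: "\<And>k. X k \<in> lp_seqs p" and C: "\<And>k. k \<ge> k0 \<Longrightarrow> lp_seq_norm p (X k) \<le> C"
    and lim: "\<And>n. (\<lambda>k. X k n) \<longlonglongrightarrow> z n"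
  shows "z \<in> lp_seqs p \<and> lp_seq_norm p z \<le> C"
proof (rule lp_seqsI_partial_sums[OF p])
  show C0: "C \<ge> 0" using C[of k0] lp_seq_norm_nonneg[of p "X k0"] by linarith
  fix M
  have "(\<lambda>k. \<Sum>n<M. norm (X k n) powr p) \<longlonglongrightarrow> (\<Sum>n<M. norm (z n) powr p)"
    using p lim by (intro tendsto_sum tendsto_powr' tendsto_norm tendsto_const) auto
  moreover have "(\<Sum>n<M. norm (X k n) powr p) \<le> C powr p" if "k \<ge> k0" for k
    using lp_partial_sums_le[OF p X[of k], of M] powr_mono2[OF _ lp_seq_norm_nonneg C[OF that], of p] p
    by linarith
  ultimately show "(\<Sum>n<M. norm (z n) powr p) \<le> C powr p"
    by (intro Lim_bounded[where M = k0]) auto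
qed

lemma lp_solid:
  assumes p: "p \<ge> 1" and x: "x \<in> lp_seqs p" and le: "\<And>n. norm (y n) \<le> norm (x n)"
  shows "y \<in> lp_seqs p \<and> lp_seq_norm p y \<le> lp_seq_norm p x"
proof (rule lp_seqsI_partial_sums[OF p lp_seq_norm_nonneg])
  fix M
  have "(\<Sum>n<M. norm (y n) powr p) \<le> (\<Sum>n<M. norm (x n) powr p)"
    using p le by (intro sum_mono powr_mono2) auto
  then show "(\<Sum>n<M. norm (y n) powr p) \<le> lp_seq_norm p x powr p"
    using lp_partial_sums_le[OF p x, of M] by linarith
qed

lemma seq_space_lp:
  assumes p: "p \<ge> 1"
  shows "seq_space (lp_seqs p) (lp_seq_norm p)"
proof
  fix k :: nat
  have *: "(\<lambda>n. if n = k then 1 else 0) \<in> lp_seqs p \<and> lp_seq_norm p (\<lambda>n. if n = k then 1 else 0) \<le> 1"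
  proof (rule lp_seqsI_partial_sums[OF p])
    fix M
    have "(\<Sum>n<M. norm (if n = k then 1 else 0 :: complex) powr p) = (\<Sum>n<M. if n = k then 1 else 0)"
      by (intro sum.cong) auto
    then show "(\<Sum>n<M. norm (if n = k then 1 else 0 :: complex) powr p) \<le> 1 powr p" by simp
  qed simp
  then show "(\<lambda>n. if n = k then 1 else 0) \<in> lp_seqs p" "lp_seq_norm p (\<lambda>n. if n = k then 1 else 0) \<le> 1" by auto
next
  fix x y :: "nat \<Rightarrow> complex" assume x: "x \<in> lp_seqs p"
  show "y \<in> lp_seqs p \<and> lp_seq_norm p y \<le> lp_seq_norm p x" if "\<And>n. norm (y n) \<le> norm (x n)"
    using lp_solid[OF p x that] .
  show "(\<lambda>n. x n + y n) \<in> lp_seqs p \<and> lp_seq_norm p (\<lambda>n. x n + y n) \<le> lp_seq_norm p x + lp_seq_norm p y"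
    if "y \<in> lp_seqs p" using lp_triangle[OF p x that] .
  show "norm (x n) \<le> lp_seq_norm p x" for n using lp_coord_le[OF p x] .
  show "(\<lambda>n. c * x n) \<in> lp_seqs p \<and> lp_seq_norm p (\<lambda>n. c * x n) \<le> norm c * lp_seq_norm p x" for c
  proof (rule lp_seqsI_partial_sums[OF p])
    show "norm c * lp_seq_norm p x \<ge> 0" by (simp add: lp_seq_norm_nonneg)
    fix M
    have "(\<Sum>n<M. norm (c * x n) powr p) = norm c powr p * (\<Sum>n<M. norm (x n) powr p)"
      by (simp add: norm_mult powr_mult sum_distrib_left)
    also have "\<dots> \<le> norm c powr p * lp_seq_norm p x powr p"
      by (intro mult_left_mono lp_partial_sums_le[OF p x]) auto
    finally show "(\<Sum>n<M. norm (c * x n) powr p) \<le> (norm c * lp_seq_norm p x) powr p"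
      by (simp add: powr_mult lp_seq_norm_nonneg)
  qed
  show "(\<lambda>n. x (Suc n)) \<in> lp_seqs p \<and> lp_seq_norm p (\<lambda>n. x (Suc n)) \<le> lp_seq_norm p x"
  proof (rule lp_seqsI_partial_sums[OF p lp_seq_norm_nonneg])
    fix M
    have "(\<Sum>n<M. norm (x (Suc n)) powr p) \<le> (\<Sum>n<Suc M. norm (x n) powr p)"
      by (simp add: sum.lessThan_Suc_shift del: sum.lessThan_Suc)
    then show "(\<Sum>n<M. norm (x (Suc n)) powr p) \<le> lp_seq_norm p x powr p"
      using lp_partial_sums_le[OF p x, of "Suc M"] by linarith
  qed
  show "(\<lambda>n. if n < k then 0 else x (n - k)) \<in> lp_seqs p \<and>
    lp_seq_norm p (\<lambda>n. if n < k then 0 else x (n - k)) \<le> lp_seq_norm p x" for k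
  proof (rule lp_seqsI_partial_sums[OF p lp_seq_norm_nonneg])
    fix M
    have "(\<Sum>n<M. norm (if n < k then 0 else x (n - k)) powr p) \<le> (\<Sum>n<M+k. norm (if n < k then 0 else x (n - k)) powr p)"
      by (intro sum_mono2) auto
    also have "\<dots> = (\<Sum>n\<in>{k..<M+k}. norm (if n < k then 0 else x (n - k)) powr p)"
      by (intro sum.mono_neutral_right) auto
    also have "\<dots> = (\<Sum>n<M. norm (x n) powr p)"
      using sum.shift_bounds_nat_ivl[of "\<lambda>n. norm (if n < k then 0 else x (n - k)) powr p" 0 k M]
      by (simp add: lessThan_atLeast0)
    finally show "(\<Sum>n<M. norm (if n < k then 0 else x (n - k)) powr p) \<le> lp_seq_norm p x powr p"
      using lp_partial_sums_le[OF p x, of M] by linarith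
  qed
  show "(\<lambda>K. lp_seq_norm p (\<lambda>n. if n < K then 0 else x n)) \<longlonglongrightarrow> 0"
  proof -
    have s: "summable (\<lambda>n. norm (x n) powr p)" using x by (simp add: lp_seqs_def)
    have eq: "(\<Sum>n. norm (if n < K then 0 else x n) powr p) = (\<Sum>n. norm (x (n + K)) powr p)" for K
    proof -
      have "summable (\<lambda>j. norm (if j + K < K then 0 else x (j + K)) powr p)"
        using s by (simp add: summable_iff_shift[of "\<lambda>n. norm (x n) powr p"])
      from suminf_offset[of "\<lambda>n. norm (if n < K then 0 else x n) powr p", OF this]
      show ?thesis by simp
    qed
    have "(\<lambda>K. (\<Sum>n. norm (x (n + K)) powr p) powr (1/p)) \<longlonglongrightarrow> 0 powr (1/p)"
      using p by (intro tendsto_powr' suminf_exist_split2[OF s] tendsto_const) (auto intro!: always_eventually suminf_nonneg simp: s summable_iff_shift[of "\<lambda>n. norm (x n) powr p"])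
    then show ?thesis unfolding lp_seq_norm_def eq using p by simp
  qed
next
  fix X :: "nat \<Rightarrow> nat \<Rightarrow> complex" and d :: "nat \<Rightarrow> real" and z
  assume X: "\<And>k. X k \<in> lp_seqs p" and bd: "\<And>k l. k \<le> l \<Longrightarrow> lp_seq_norm p (\<lambda>n. X l n - X k n) \<le> d k"
    and lim: "\<And>n. (\<lambda>k. X k n) \<longlonglongrightarrow> z n"
  have mem: "(\<lambda>n. X l n - X k n) \<in> lp_seqs p" for k l
    using lp_triangle[OF p X[of l], of "\<lambda>n. - X k n"] lp_solid[OF p X[of k], of "\<lambda>n. - X k n"] by simp
  have *: "(\<lambda>n. z n - X k n) \<in> lp_seqs p \<and> lp_seq_norm p (\<lambda>n. z n - X k n) \<le> d k" for k
    by (rule lp_fatou[OF p mem bd]) (auto intro: tendsto_diff lim)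
  have "z \<in> lp_seqs p"
    using lp_triangle[OF p conjunct1[OF *[of 0]] X[of 0]] by simp
  then show "z \<in> lp_seqs p \<and> (\<forall>k. lp_seq_norm p (\<lambda>n. z n - X k n) \<le> d k)" using * by blast
qed

section \<open>The space c_0\<close>

lemma c0_coord_le:
  assumes "x \<in> c0_seqs"
  shows "norm (x n) \<le> c0_seq_norm x"
proof -
  have "x \<longlonglongrightarrow> 0" using assms by (simp add: c0_seqs_def)
  then have "Bseq x" by (intro convergent_imp_Bseq) (auto simp: convergent_def)
  then have "bdd_above (range (\<lambda>n. norm (x n)))" by (simp add: Bseq_eq_bounded bounded_norm_comp bounded_imp_bdd_above)
  then show ?thesis unfolding c0_seq_norm_def by (intro cSUP_upper) auto
qed

lemma c0_seq_norm_le: "(\<And>n. norm (x n) \<le> C) \<Longrightarrow> c0_seq_norm x \<le> C"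
  unfolding c0_seq_norm_def by (intro cSUP_least) auto

lemma seq_space_c0: "seq_space c0_seqs c0_seq_norm"
proof
  fix k :: nat
  have "\<forall>\<^sub>F n in sequentially. (if n = k then 1 else 0 :: complex) = 0"
    using eventually_gt_at_top[of k] by eventually_elim auto
  then show "(\<lambda>n. if n = k then 1 else 0) \<in> c0_seqs"
    unfolding c0_seqs_def by (simp add: tendsto_eventually)
  show "c0_seq_norm (\<lambda>n. if n = k then 1 else 0) \<le> 1" by (rule c0_seq_norm_le) auto
next
  fix x y :: "nat \<Rightarrow> complex" assume x: "x \<in> c0_seqs"
  then have x0: "x \<longlonglongrightarrow> 0" by (simp add: c0_seqs_def)
  note xc = c0_coord_le[OF x]
  show "y \<in> c0_seqs \<and> c0_seq_norm y \<le> c0_seq_norm x" if le: "\<And>n. norm (y n) \<le> norm (x n)"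
  proof -
    have "y \<longlonglongrightarrow> 0" by (rule tendsto_0_le[OF x0, of _ 1]) (use le in auto)
    moreover have "c0_seq_norm y \<le> c0_seq_norm x"
      by (rule c0_seq_norm_le) (use le xc order_trans in blast)
    ultimately show ?thesis by (simp add: c0_seqs_def)
  qed
  show "(\<lambda>n. x n + y n) \<in> c0_seqs \<and> c0_seq_norm (\<lambda>n. x n + y n) \<le> c0_seq_norm x + c0_seq_norm y"
    if y: "y \<in> c0_seqs"
    using y x0 tendsto_add[of x 0 sequentially y 0] xc c0_coord_le[OF y]
    by (auto intro!: c0_seq_norm_le norm_triangle_le add_mono simp: c0_seqs_def)
  show "norm (x n) \<le> c0_seq_norm x" for n by (rule xc)
  show "(\<lambda>n. c * x n) \<in> c0_seqs \<and> c0_seq_norm (\<lambda>n. c * x n) \<le> norm c * c0_seq_norm x" for c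
    using tendsto_mult_right_zero[OF x0] xc
    by (auto intro!: c0_seq_norm_le mult_left_mono simp: c0_seqs_def norm_mult)
  show "(\<lambda>n. x (Suc n)) \<in> c0_seqs \<and> c0_seq_norm (\<lambda>n. x (Suc n)) \<le> c0_seq_norm x"
    using LIMSEQ_Suc[OF x0] xc by (auto intro!: c0_seq_norm_le simp: c0_seqs_def)
  have nn: "c0_seq_norm x \<ge> 0" using xc[of 0] norm_ge_zero[of "x 0"] by linarith
  show "(\<lambda>n. if n < k then 0 else x (n - k)) \<in> c0_seqs \<and>
    c0_seq_norm (\<lambda>n. if n < k then 0 else x (n - k)) \<le> c0_seq_norm x" for k
  proof -
    have "(\<lambda>n. if n < k then 0 else x (n - k)) \<longlonglongrightarrow> 0"
      using LIMSEQ_offset[of "\<lambda>n. if n < k then 0 else x (n - k)" k 0] x0 by simp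
    then show ?thesis using xc nn by (auto intro!: c0_seq_norm_le simp: c0_seqs_def)
  qed
  show "(\<lambda>K. c0_seq_norm (\<lambda>n. if n < K then 0 else x n)) \<longlonglongrightarrow> 0"
  proof (rule LIMSEQ_I)
    fix e :: real assume e: "e > 0"
    then obtain K0 where K0: "\<And>n. n \<ge> K0 \<Longrightarrow> norm (x n) < e/2"
      using LIMSEQ_D[OF x0, of "e/2"] by auto
    have "norm (c0_seq_norm (\<lambda>n. if n < K then 0 else x n) - 0) < e" if "K \<ge> K0" for K
    proof -
      have u: "c0_seq_norm (\<lambda>n. if n < K then 0 else x n) \<le> e/2"
        by (rule c0_seq_norm_le) (use K0 that e in \<open>auto simp: less_imp_le\<close>)
      have "(\<lambda>n. if n < K then 0 else x n) \<longlonglongrightarrow> 0"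
        by (rule tendsto_0_le[OF x0, of _ 1]) auto
      then have "c0_seq_norm (\<lambda>n. if n < K then 0 else x n) \<ge> 0"
        using c0_coord_le[of "\<lambda>n. if n < K then 0 else x n" 0] norm_ge_zero[of "if 0 < K then 0 else x 0"]
        unfolding c0_seqs_def mem_Collect_eq by linarith
      then show ?thesis using u e by simp
    qed
    then show "\<exists>no. \<forall>n\<ge>no. norm (c0_seq_norm (\<lambda>m. if m < n then 0 else x m) - 0) < e" by blast
  qed
next
  fix X :: "nat \<Rightarrow> nat \<Rightarrow> complex" and d :: "nat \<Rightarrow> real" and z
  assume X: "\<And>k. X k \<in> c0_seqs" and bd: "\<And>k l. k \<le> l \<Longrightarrow> c0_seq_norm (\<lambda>n. X l n - X k n) \<le> d k"
    and d: "d \<longlonglongrightarrow> 0" and lim: "\<And>n. (\<lambda>k. X k n) \<longlonglongrightarrow> z n"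
  have mem: "(\<lambda>n. X l n - X k n) \<in> c0_seqs" for k l
    using X[of l] X[of k] tendsto_diff[of "X l" 0 sequentially "X k" 0] by (auto simp: c0_seqs_def)
  have zX: "norm (z n - X k n) \<le> d k" for n k
  proof (rule Lim_bounded[of "\<lambda>l. norm (X l n - X k n)" _ k])
    show "(\<lambda>l. norm (X l n - X k n)) \<longlonglongrightarrow> norm (z n - X k n)"
      by (intro tendsto_intros lim)
    show "\<forall>l\<ge>k. norm (X l n - X k n) \<le> d k"
      using c0_coord_le[OF mem] bd order_trans by blast
  qed
  have "z \<longlonglongrightarrow> 0"
  proof (rule LIMSEQ_I)
    fix e :: real assume e: "e > 0"
    have "\<forall>\<^sub>F k in sequentially. d k < e/2" using order_tendstoD(2)[OF d, of "e/2"] e by simp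
    then obtain k where k: "d k < e/2" by (auto simp: eventually_sequentially)
    obtain n0 where n0: "\<And>n. n \<ge> n0 \<Longrightarrow> norm (X k n) < e/2"
      using LIMSEQ_D[of "X k" 0 "e/2"] X[of k] e by (auto simp: c0_seqs_def)
    have "norm (z n - 0) < e" if "n \<ge> n0" for n
      using norm_triangle_ineq[of "z n - X k n" "X k n"] zX[of n k] k n0[OF that] by simp
    then show "\<exists>no. \<forall>n\<ge>no. norm (z n - 0) < e" by blast
  qed
  then show "z \<in> c0_seqs \<and> (\<forall>k. c0_seq_norm (\<lambda>n. z n - X k n) \<le> d k)"
    using zX by (auto intro: c0_seq_norm_le simp: c0_seqs_def)
qed

section \<open>The backward shift in coordinates\<close>

definition taylor_coeff :: "(nat \<Rightarrow> complex) \<Rightarrow> (nat \<Rightarrow> complex) \<Rightarrow> (nat \<Rightarrow> complex) \<Rightarrow> nat \<Rightarrow> complex" where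
  "taylor_coeff a b l n = l n * a n + (if n = 0 then 0 else l (n - 1) * b (n - 1))"

text \<open>Coordinates of z^k, from solving the bidiagonal recursion a_m l_m = - b_(m-1) l_(m-1)
  for m > k with l_k = 1 / a_k. The formula is formal; membership in the sequence space is a
  separate matter.\<close>

definition monomial_coords :: "(nat \<Rightarrow> complex) \<Rightarrow> (nat \<Rightarrow> complex) \<Rightarrow> nat \<Rightarrow> nat \<Rightarrow> complex" where
  "monomial_coords a b k m = (if m < k then 0 else (-1) ^ (m - k) * ratio_prod a b k (m - k) / a k)"

text \<open>Column 0 needs its own value, because \<open>shift_coeff\<close> at 0 would read the
  index 0 - 1 as 0 and subtract a spurious term. Here B_w f_0 is the constant w_1 b_0.\<close>

definition lower_coeff :: "(nat \<Rightarrow> complex) \<Rightarrow> (nat \<Rightarrow> complex) \<Rightarrow> (nat \<Rightarrow> complex) \<Rightarrow> nat \<Rightarrow> complex" where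
  "lower_coeff a b w k = (if k = 0 then w 1 * b 0 / a 0 else shift_coeff a b w k)"

text \<open>The matrix of the backward shift in the basis \<open>f\<^sub>n\<close>: one superdiagonal, and the
  lower triangle read off from
  \<open>B\<^sub>w f\<^sub>k = (w\<^sub>k a\<^sub>k / a\<^sub>k\<^sub>-\<^sub>1) f\<^sub>k\<^sub>-\<^sub>1 + c\<^sub>k a\<^sub>k z\<^sup>k\<close>.\<close>

definition coord_shift ::
  "(nat \<Rightarrow> complex) \<Rightarrow> (nat \<Rightarrow> complex) \<Rightarrow> (nat \<Rightarrow> complex) \<Rightarrow> (nat \<Rightarrow> complex) \<Rightarrow> nat \<Rightarrow> complex" where
  "coord_shift a b w l m = w (Suc m) * a (Suc m) / a m * l (Suc m) +
     (\<Sum>k\<le>m. lower_coeff a b w k * a k * monomial_coords a b k m * l k)"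

lemma ratio_prod_0 [simp]: "ratio_prod a b k 0 = 1"
  by (simp add: ratio_prod_def)

lemma ratio_prod_Suc: "ratio_prod a b k (Suc j) = ratio_prod a b k j * (b (k + j) / a (Suc (k + j)))"
  by (simp add: ratio_prod_def)

lemma ratio_prod_add: "ratio_prod a b k (i + j) = ratio_prod a b k i * ratio_prod a b (k + i) j"
  by (induction j) (simp_all add: ratio_prod_Suc add.assoc)

text \<open>A bidiagonal system with non-zero diagonal is solved recursively. Identities between
  iterates in coordinates are proved through this lemma.\<close>

lemma taylor_coeff_inject:
  assumes a: "\<And>n. a n \<noteq> 0" and eq: "\<And>n. taylor_coeff a b l n = taylor_coeff a b l' n"
  shows "l = l'"
proof
  fix n show "l n = l' n"
  proof (induction n)
    case 0 then show ?case using eq[of 0] a[of 0] by (simp add: taylor_coeff_def)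
  next
    case (Suc n) then show ?case using eq[of "Suc n"] a[of "Suc n"] by (simp add: taylor_coeff_def)
  qed
qed

lemma taylor_coeff_add: "taylor_coeff a b (\<lambda>n. x n + y n) n = taylor_coeff a b x n + taylor_coeff a b y n"
  by (simp add: taylor_coeff_def algebra_simps)

lemma taylor_coeff_scale: "taylor_coeff a b (\<lambda>n. c * x n) n = c * taylor_coeff a b x n"
  by (simp add: taylor_coeff_def algebra_simps)

lemma taylor_coeff_sum: "taylor_coeff a b (\<lambda>n. \<Sum>i\<in>I. x i n) n = (\<Sum>i\<in>I. taylor_coeff a b (x i) n)"
  by (simp add: taylor_coeff_def sum_distrib_right sum.distrib)

lemma taylor_coeff_bound:
  assumes "\<And>n. norm (l n) \<le> C"
  shows "norm (taylor_coeff a b l n) \<le> C * (norm (a n) + norm (b (n - 1)))"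
proof -
  have "norm (taylor_coeff a b l n) \<le> norm (l n) * norm (a n) + norm (l (n - 1)) * norm (b (n - 1))"
    unfolding taylor_coeff_def by (rule norm_triangle_le) (auto simp: norm_mult)
  also have "\<dots> \<le> C * norm (a n) + C * norm (b (n - 1))" by (intro add_mono mult_right_mono assms) auto
  finally show ?thesis by (simp add: algebra_simps)
qed

lemma taylor_coeff_monomial:
  assumes a: "\<And>n. a n \<noteq> 0"
  shows "taylor_coeff a b (monomial_coords a b k) n = (if n = k then 1 else 0)"
proof -
  consider "n < k" | "n = k" | j where "n = Suc (k + j)"
    using less_imp_Suc_add[of k n] by (meson linorder_neqE_nat)
  then show ?thesis
  proof cases
    case 3
    have "taylor_coeff a b (monomial_coords a b k) n =
      (-1) ^ Suc j * (ratio_prod a b k j * (b (k + j) / a (Suc (k + j)))) / a k * a (Suc (k + j))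
        + (-1) ^ j * ratio_prod a b k j / a k * b (k + j)"
      unfolding 3 taylor_coeff_def monomial_coords_def by (simp add: ratio_prod_Suc Suc_diff_le)
    also have "\<dots> = 0" using a by (simp add: field_simps)
    finally show ?thesis using 3 by simp
  qed (use a in \<open>auto simp: taylor_coeff_def monomial_coords_def\<close>)
qed

text \<open>Justifies the matrix: on Taylor coefficients it acts as the weighted backward shift.
  This holds for every sequence, without any convergence, since each row is a finite sum.\<close>

lemma taylor_coeff_coord_shift:
  assumes a: "\<And>n. a n \<noteq> 0"
  shows "taylor_coeff a b (coord_shift a b w l) n = w (Suc n) * taylor_coeff a b l (Suc n)"
proof -
  let ?up = "\<lambda>m. w (Suc m) * a (Suc m) / a m * l (Suc m)"
  let ?u = "\<lambda>k m. lower_coeff a b w k * a k * l k * monomial_coords a b k m"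
  let ?low = "\<lambda>m. \<Sum>k\<le>n. ?u k m"
  \<comment> \<open>Column k of the lower part is zero above row k, so the sum may run over the
    fixed range k \<le> n; only then do the linearity rules for \<open>taylor_coeff\<close>
    apply.\<close>
  have split: "coord_shift a b w l m = ?up m + ?low m" if "m \<le> n" for m
  proof -
    have "(\<Sum>k\<le>m. ?u k m) = ?low m"
      using that by (intro sum.mono_neutral_left) (auto simp: monomial_coords_def)
    then show ?thesis by (simp add: coord_shift_def mult_ac)
  qed
  have "taylor_coeff a b (coord_shift a b w l) n = taylor_coeff a b (\<lambda>m. ?up m + ?low m) n"
    by (auto simp: taylor_coeff_def split)
  also have "\<dots> = taylor_coeff a b ?up n + (\<Sum>k\<le>n. lower_coeff a b w k * a k * l k * (if n = k then 1 else 0))"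
    unfolding taylor_coeff_add taylor_coeff_sum taylor_coeff_scale taylor_coeff_monomial[OF a] ..
  also have "(\<Sum>k\<le>n. lower_coeff a b w k * a k * l k * (if n = k then 1 else 0)) = lower_coeff a b w n * a n * l n"
    by (simp add: if_distrib[of "\<lambda>t. _ * t"] cong: if_cong)
  also have "taylor_coeff a b ?up n + lower_coeff a b w n * a n * l n = w (Suc n) * taylor_coeff a b l (Suc n)"
  proof (cases n)
    case 0
    then show ?thesis using a[of 0] by (simp add: taylor_coeff_def lower_coeff_def field_simps)
  next
    case (Suc m)
    \<comment> \<open>The origin of c_n: the superdiagonal term contributes w_n a_n b_(n-1) /
      a_(n-1) to the coefficient of z^n instead of the correct w_(n+1) b_n, and a_n c_n is the
      difference.\<close>
    have "w n * a n / a m * l n * b m + (w (Suc n) * (b n / a n) - w n * (b m / a m)) * a n * l n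
        = w (Suc n) * (l n * b n)"
      using a[of m] a[of n] by (simp add: field_simps)
    then have "w (Suc n) * a (Suc n) / a n * l (Suc n) * a n + w n * a n / a m * l n * b m
        + (w (Suc n) * (b n / a n) - w n * (b m / a m)) * a n * l n
        = w (Suc n) * (l (Suc n) * a (Suc n) + l n * b n)"
      using a[of n] by (simp add: distrib_left)
    then show ?thesis using Suc by (simp add: taylor_coeff_def lower_coeff_def shift_coeff_def)
  qed
  finally show ?thesis .
qed

lemma taylor_coeff_coord_shift_power:
  assumes a: "\<And>n. a n \<noteq> 0"
  shows "(\<Prod>k=1..m. w k) * taylor_coeff a b ((coord_shift a b w ^^ n) l) m =
         (\<Prod>k=1..m+n. w k) * taylor_coeff a b l (m + n)"
proof (induction n arbitrary: m)
  case (Suc n)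
  have "taylor_coeff a b ((coord_shift a b w ^^ Suc n) l) m = w (Suc m) * taylor_coeff a b ((coord_shift a b w ^^ n) l) (Suc m)"
    using taylor_coeff_coord_shift[where a = a and b = b and w = w and n = m and l = "(coord_shift a b w ^^ n) l", OF a] by simp
  then show ?case using Suc[of "Suc m"] by (simp only:) (simp add: mult.assoc)
qed simp

lemma coord_shift_diff: "coord_shift a b w (\<lambda>n. x n - y n) = (\<lambda>n. coord_shift a b w x n - coord_shift a b w y n)"
  by (simp add: coord_shift_def fun_eq_iff algebra_simps sum_subtractf diff_divide_distrib)

lemma coord_shift_add: "coord_shift a b w (\<lambda>n. x n + y n) = (\<lambda>n. coord_shift a b w x n + coord_shift a b w y n)"
  by (simp add: coord_shift_def fun_eq_iff algebra_simps sum.distrib add_divide_distrib)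

lemma coord_shift_scale: "coord_shift a b w (\<lambda>n. c * x n) = (\<lambda>n. c * coord_shift a b w x n)"
  by (simp add: coord_shift_def fun_eq_iff algebra_simps sum_distrib_left)

section \<open>Bounds on the diagonals of the matrix\<close>

text \<open>\<open>M\<close> bounds the superdiagonal and \<alpha> n the n-th diagonal below it,
  uniformly over the columns k, with n = 0 the main diagonal. The factor \<open>a k\<close> of a
  matrix entry cancels the 1 / \<open>a k\<close> in \<open>monomial_coords\<close>, which leaves
  the product bounded here, up to sign.\<close>

locale shift_bounds =
  fixes a b w :: "nat \<Rightarrow> complex" and M :: real and \<alpha> :: "nat \<Rightarrow> real"
  assumes a_nz: "a n \<noteq> 0" and w_nz: "w n \<noteq> 0" and M_nonneg: "M \<ge> 0"
    and M_bound: "norm (w (Suc n) * a (Suc n) / a n) \<le> M"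
    and \<alpha>_summable: "summable \<alpha>"
    and \<alpha>_bound: "norm (lower_coeff a b w k * ratio_prod a b k n) \<le> \<alpha> n"
begin

lemma \<alpha>_nonneg: "\<alpha> n \<ge> 0"
  using \<alpha>_bound[of 0 n] norm_ge_zero order_trans by blast

lemma coord_shift_bound:
  "norm (coord_shift a b w l m) \<le> M * norm (l (Suc m)) + (\<Sum>n\<le>m. \<alpha> n * norm (l (m - n)))"
proof -
  let ?t = "\<lambda>k. lower_coeff a b w k * a k * monomial_coords a b k m * l k"
  have "norm (?t k) \<le> \<alpha> (m - k) * norm (l k)" if "k \<le> m" for k
  proof -
    have "norm (?t k) = norm (lower_coeff a b w k * ratio_prod a b k (m - k)) * norm (l k)"
      using that a_nz[of k] by (simp add: monomial_coords_def norm_mult norm_divide norm_power)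
    also have "\<dots> \<le> \<alpha> (m - k) * norm (l k)" by (intro mult_right_mono \<alpha>_bound) auto
    finally show ?thesis .
  qed
  then have "norm (\<Sum>k\<le>m. ?t k) \<le> (\<Sum>k\<le>m. \<alpha> (m - k) * norm (l k))"
    by (intro sum_norm_le) auto
  also have "\<dots> = (\<Sum>n\<le>m. \<alpha> n * norm (l (m - n)))"
    by (rule sum.reindex_bij_witness[of _ "\<lambda>n. m - n" "\<lambda>k. m - k"]) auto
  finally have "norm (\<Sum>k\<le>m. ?t k) \<le> (\<Sum>n\<le>m. \<alpha> n * norm (l (m - n)))" .
  moreover have "norm (w (Suc m) * a (Suc m) / a m * l (Suc m)) \<le> M * norm (l (Suc m))"
    unfolding norm_mult[of _ "l (Suc m)"] by (intro mult_right_mono M_bound) auto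
  ultimately show ?thesis unfolding coord_shift_def by (meson add_mono norm_triangle_le)
qed

text \<open>If \<open>b\<^sub>i \<noteq> 0\<close> for all \<open>i \<ge> k\<^sub>0\<close> with \<open>k\<^sub>0\<close> minimal, then the coefficient \<open>c\<close> at
  \<open>k\<^sub>0\<close> is non-zero because \<open>k\<^sub>0 = 0\<close> or \<open>b\<close> vanishes at \<open>k\<^sub>0 - 1\<close>; so the hypothesis
  on the \<open>c\<close>'s controls the ratios themselves.\<close>

lemma ratio_prod_summable: "summable (\<lambda>n. norm (ratio_prod a b k n))"
proof (cases "\<exists>i\<ge>k. b i = 0")
  case True
  then obtain i where i: "i \<ge> k" "b i = 0" by blast
  have "ratio_prod a b k n = 0" if "n \<notin> {..i - k}" for n
    using that i by (auto simp: ratio_prod_def intro!: bexI[of _ i])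
  then show ?thesis by (intro summable_finite[of "{..i - k}"]) auto
next
  case False
  define P where "P j \<longleftrightarrow> (\<forall>i\<ge>j. b i \<noteq> 0)" for j
  define k0 where "k0 = (LEAST j. P j)"
  have "P k" using False by (auto simp: P_def)
  then have P0: "P k0" and le: "k0 \<le> k" by (auto simp: k0_def intro: LeastI Least_le)
  have nz: "lower_coeff a b w k0 \<noteq> 0"
  proof (cases k0)
    case 0
    then show ?thesis using P0 a_nz w_nz by (auto simp: P_def lower_coeff_def)
  next
    case (Suc j)
    then have "\<not> P j" using not_less_Least[of j P] by (simp add: k0_def)
    then obtain i where i: "i \<ge> j" "b i = 0" by (auto simp: P_def)
    then have "i = j" using P0 Suc by (metis P_def not_less_eq_eq le_antisym)
    then show ?thesis using i P0 Suc a_nz w_nz by (auto simp: P_def lower_coeff_def shift_coeff_def)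
  qed
  let ?c = "norm (lower_coeff a b w k0)"
  have "summable (\<lambda>n. norm (ratio_prod a b k0 n))"
  proof (rule summable_comparison_test[OF _ summable_mult[OF \<alpha>_summable, of "1 / ?c"]], intro exI allI impI)
    fix n
    show "norm (norm (ratio_prod a b k0 n)) \<le> 1 / ?c * \<alpha> n"
      using \<alpha>_bound[of k0 n] nz by (simp add: norm_mult field_simps)
  qed
  then have "summable (\<lambda>n. norm (ratio_prod a b k0 (n + (k - k0))))"
    by (rule summable_ignore_initial_segment)
  \<comment> \<open>Up to a non-zero constant, the ratios started at k are a tail of those started
    at \<open>k0\<close>.\<close>
  moreover have "norm (ratio_prod a b k0 (n + (k - k0))) = norm (ratio_prod a b k0 (k - k0)) * norm (ratio_prod a b k n)" for n
    using le ratio_prod_add[of a b k0 "k - k0" n] by (simp add: add.commute norm_mult)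
  ultimately have "summable (\<lambda>n. norm (ratio_prod a b k0 (k - k0)) * norm (ratio_prod a b k n))" by simp
  moreover have "ratio_prod a b k0 (k - k0) \<noteq> 0"
    using P0 a_nz by (auto simp: ratio_prod_def P_def)
  ultimately show ?thesis by (simp add: summable_cmult_iff)
qed

lemma monomial_coords_summable: "summable (\<lambda>n. norm (monomial_coords a b k n))"
proof -
  have "summable (\<lambda>n. norm (ratio_prod a b k n) / norm (a k))"
    by (rule summable_divide[OF ratio_prod_summable])
  then have "summable (\<lambda>n. norm (monomial_coords a b k (n + k)))"
    by (simp add: monomial_coords_def norm_mult norm_divide norm_power)
  then show ?thesis by (simp add: summable_iff_shift[of "\<lambda>n. norm (monomial_coords a b k n)"])
qed

end

section \<open>Iterates, small preimages and dense orbits in coordinates\<close>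

locale shift_space = seq_space E N + shift_bounds a b w M \<alpha> for E N a b w M \<alpha>
begin

abbreviation "S \<equiv> coord_shift a b w"
abbreviation "W n \<equiv> \<Prod>k=1..n. w k"

text \<open>The added 1 makes the bound at least 1, so its powers increase with the exponent and can
  safely be divided by.\<close>

definition op_bound :: real where "op_bound = M + (\<Sum>n. \<alpha> n) + 1"

lemma op_bound_ge_1: "op_bound \<ge> 1"
  using M_nonneg suminf_nonneg[OF \<alpha>_summable \<alpha>_nonneg] by (simp add: op_bound_def)

lemma S_closed: "x \<in> E \<Longrightarrow> S x \<in> E"
  using convolution_bound[of x \<alpha> M "S x", OF _ \<alpha>_summable \<alpha>_nonneg M_nonneg coord_shift_bound] by blast

lemma S_bound: "x \<in> E \<Longrightarrow> N (S x) \<le> op_bound * N x"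
  using convolution_bound[of x \<alpha> M "S x", OF _ \<alpha>_summable \<alpha>_nonneg M_nonneg coord_shift_bound] N_nonneg[of x]
  by (auto simp: op_bound_def algebra_simps)

lemma S_power_closed: "x \<in> E \<Longrightarrow> (S ^^ n) x \<in> E"
  by (induction n) (auto simp: S_closed)

lemma S_power_bound: "x \<in> E \<Longrightarrow> N ((S ^^ n) x) \<le> op_bound ^ n * N x"
proof (induction n)
  case (Suc n)
  have "N ((S ^^ Suc n) x) \<le> op_bound * N ((S ^^ n) x)" using S_bound S_power_closed Suc by simp
  also have "\<dots> \<le> op_bound * (op_bound ^ n * N x)"
    using Suc op_bound_ge_1 by (intro mult_left_mono) auto
  finally show ?case by (simp add: mult_ac)
qed simp

lemma S_power_diff: "(S ^^ n) (\<lambda>i. x i - y i) = (\<lambda>i. (S ^^ n) x i - (S ^^ n) y i)"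
  by (induction n) (simp_all add: coord_shift_diff)

lemma S_power_add: "(S ^^ n) (\<lambda>i. x i + y i) = (\<lambda>i. (S ^^ n) x i + (S ^^ n) y i)"
  by (induction n) (simp_all add: coord_shift_add)

lemma W_nz: "W n \<noteq> 0" using w_nz by auto

lemma taylor_coeff_S_power: "taylor_coeff a b ((S ^^ n) l) m = W (m + n) / W m * taylor_coeff a b l (m + n)"
  using taylor_coeff_coord_shift_power[where a = a and b = b and w = w and m = m and n = n and l = l] a_nz W_nz[of m] by (simp add: field_simps)

text \<open>Polynomials are killed by high powers; this lets earlier summands of the hypercyclic
  vector disappear at later times.\<close>

lemma S_power_eq_zero:
  assumes "\<And>m. m \<ge> K \<Longrightarrow> taylor_coeff a b x m = 0" "n \<ge> K"
  shows "(S ^^ n) x = (\<lambda>_. 0)"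
proof (rule taylor_coeff_inject[where a = a and b = b, OF a_nz])
  fix m show "taylor_coeff a b ((S ^^ n) x) m = taylor_coeff a b (\<lambda>_. 0) m"
    using assms(1)[of "m + n"] assms(2) unfolding taylor_coeff_S_power by (simp add: taylor_coeff_def)
qed

lemma monomial_closed: "monomial_coords a b k \<in> E"
  by (rule summable_in_space[OF monomial_coords_summable])

definition scaled_monomial :: "nat \<Rightarrow> nat \<Rightarrow> complex" where
  "scaled_monomial n = (\<lambda>m. (1 / W n) * monomial_coords a b n m)"

lemma scaled_monomial_closed: "scaled_monomial n \<in> E" unfolding scaled_monomial_def using scale[OF monomial_closed] by blast

lemma N_scaled_monomial_le: "N (scaled_monomial n) \<le> N (monomial_coords a b n) / norm (W n)"
  using scale[OF monomial_closed, of "1 / W n" n] by (simp add: scaled_monomial_def norm_divide)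

lemma taylor_coeff_scaled_monomial: "taylor_coeff a b (scaled_monomial n) m = (if m = n then 1 / W n else 0)"
  unfolding scaled_monomial_def taylor_coeff_scale taylor_coeff_monomial[where a = a, OF a_nz] by simp

lemma N_scaled_monomial_pos: "N (scaled_monomial n) > 0"
proof -
  have "scaled_monomial n n \<noteq> 0" using W_nz[of n] a_nz by (simp add: scaled_monomial_def monomial_coords_def)
  then show ?thesis using coord[OF scaled_monomial_closed, of n n] by (smt (verit) zero_less_norm_iff)
qed

lemma S_power_scaled_monomial: "(S ^^ j) (scaled_monomial (n + j)) = scaled_monomial n"
  by (rule taylor_coeff_inject[where a = a and b = b, OF a_nz]) (use W_nz in \<open>auto simp: taylor_coeff_S_power taylor_coeff_scaled_monomial\<close>)

text \<open>Turns one very small scaled monomial into a window of J+1 consecutive small ones at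
  arbitrarily high position, by descending from index i with at most J applications of
  \<open>S\<close>.\<close>

lemma small_scaled_monomial:
  assumes unb: "\<And>C. \<exists>n. norm (W n) > C * N (monomial_coords a b n)" and e: "e > 0"
  shows "\<exists>n\<ge>n0. \<forall>j\<le>J. N (scaled_monomial (n + j)) < e"
proof -
  \<comment> \<open>The bound e / \<open>op_bound ^ J\<close> pays for the descent. Staying below
    the norms, all positive, of the scaled monomials of index less than n0 + J forces the chosen
    index to be at least n0 + J.\<close>
  define \<delta> where "\<delta> = Min (insert (e / op_bound ^ J) ((\<lambda>i. N (scaled_monomial i)) ` {..<n0 + J}))"
  have op: "op_bound > 0" using op_bound_ge_1 by simp
  have \<delta>: "\<delta> > 0" unfolding \<delta>_def using e op N_scaled_monomial_pos by (subst Min_gr_iff) auto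
  have \<delta>_le: "\<delta> \<le> e / op_bound ^ J" "\<And>i. i < n0 + J \<Longrightarrow> \<delta> \<le> N (scaled_monomial i)"
    unfolding \<delta>_def by (auto intro: Min_le)
  obtain i where i: "norm (W i) > 1 / \<delta> * N (monomial_coords a b i)" using unb by blast
  have "N (scaled_monomial i) < \<delta>"
  proof -
    have "N (monomial_coords a b i) / norm (W i) < \<delta>"
      using i \<delta> W_nz[of i] by (simp add: field_simps)
    then show ?thesis using N_scaled_monomial_le[of i] by simp
  qed
  then have iJ: "i \<ge> n0 + J" using \<delta>_le(2)[of i] by (meson not_le)
  have "N (scaled_monomial (i - J + j)) < e" if j: "j \<le> J" for j
  proof -
    have "scaled_monomial (i - J + j) = (S ^^ (J - j)) (scaled_monomial i)"
      using S_power_scaled_monomial[of "J - j" "i - J + j"] iJ j by simp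
    then have "N (scaled_monomial (i - J + j)) \<le> op_bound ^ (J - j) * N (scaled_monomial i)"
      using S_power_bound[OF scaled_monomial_closed] by simp
    also have "\<dots> \<le> op_bound ^ J * N (scaled_monomial i)"
      using op_bound_ge_1 N_nonneg[OF scaled_monomial_closed] by (intro mult_right_mono power_increasing) auto
    also have "\<dots> < op_bound ^ J * (e / op_bound ^ J)"
      using \<open>N (scaled_monomial i) < \<delta>\<close> \<delta>_le(1) op by (intro mult_strict_left_mono) auto
    also have "\<dots> = e" using op by simp
    finally show ?thesis .
  qed
  then show ?thesis using iJ by (intro exI[of _ "i - J"]) auto
qed

text \<open>In the polynomial \<open>y\<close>, each scaled monomial of index k is replaced by the
  one of index n + k, which \<open>S ^^ n\<close> sends back to it. The preimage is again a
  polynomial, so its own iterates eventually vanish, as the inductive construction of the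
  hypercyclic vector requires.\<close>

lemma small_preimage:
  assumes unb: "\<And>C. \<exists>n. norm (W n) > C * N (monomial_coords a b n)" and e: "e > 0"
    and y: "\<And>n. n \<ge> K \<Longrightarrow> y n = 0"
  shows "\<exists>n\<ge>n0. \<exists>x\<in>E. N x < e \<and> (S ^^ n) x = y \<and> (\<exists>L. \<forall>m\<ge>L. (S ^^ m) x = (\<lambda>_. 0))"
proof -
  define t where "t = taylor_coeff a b y"
  \<comment> \<open>Coordinates below K give degree up to K, since f_(K-1) reaches z^K.\<close>
  have t0: "t n = 0" if "n > K" for n using y[of n] y[of "n - 1"] that by (simp add: t_def taylor_coeff_def)
  \<comment> \<open>The added 1 makes A positive and gives the strict inequality (A - 1) * (e / A) <
    e.\<close>
  define A where "A = (\<Sum>k\<le>K. norm (t k * W k)) + 1"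
  have A: "A > 0" using sum_nonneg[of "{..K}" "\<lambda>k. norm (t k * W k)"] by (simp add: A_def)
  obtain n where n: "n \<ge> n0" "\<And>j. j \<le> K \<Longrightarrow> N (scaled_monomial (n + j)) < e / A"
    using small_scaled_monomial[OF unb, of "e / A" n0 K] e A by auto
  define x where "x = (\<lambda>m. \<Sum>k\<le>K. (t k * W k) * scaled_monomial (n + k) m)"
  have tx: "taylor_coeff a b x m = (\<Sum>k\<le>K. if m = n + k then t k * W k / W m else 0)" for m
    unfolding x_def taylor_coeff_sum taylor_coeff_scale taylor_coeff_scaled_monomial by (intro sum.cong) auto
  have sc: "(\<lambda>m. (t k * W k) * scaled_monomial (n + k) m) \<in> E \<and> N (\<lambda>m. (t k * W k) * scaled_monomial (n + k) m) \<le> norm (t k * W k) * N (scaled_monomial (n + k))" for k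
    by (rule scale[OF scaled_monomial_closed])
  have x: "x \<in> E" "N x \<le> (\<Sum>k\<le>K. N (\<lambda>m. (t k * W k) * scaled_monomial (n + k) m))"
    using sum_closed[of "{..K}" "\<lambda>k m. (t k * W k) * scaled_monomial (n + k) m"] sc by (auto simp: x_def)
  have "N x \<le> (\<Sum>k\<le>K. norm (t k * W k) * (e / A))"
  proof (rule order_trans[OF x(2)], rule sum_mono)
    fix k assume "k \<in> {..K}"
    then have "norm (t k * W k) * N (scaled_monomial (n + k)) \<le> norm (t k * W k) * (e / A)"
      using n(2)[of k] by (intro mult_left_mono) auto
    then show "N (\<lambda>m. (t k * W k) * scaled_monomial (n + k) m) \<le> norm (t k * W k) * (e / A)" using sc[of k] by linarith
  qed
  also have "\<dots> = (A - 1) * (e / A)" by (simp only: sum_distrib_right[symmetric]) (simp add: A_def)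
  also have "\<dots> < e" using A e by (simp add: field_simps)
  finally have Nx: "N x < e" .
  have "(S ^^ n) x = y"
  proof (rule taylor_coeff_inject[where a = a and b = b, OF a_nz])
    fix m
    have "taylor_coeff a b ((S ^^ n) x) m = W (m + n) / W m * (\<Sum>k\<le>K. if m = k then t k * W k / W (m + n) else 0)"
      unfolding taylor_coeff_S_power tx by (simp add: add.commute)
    also have "\<dots> = t m" using W_nz[of m] W_nz[of "m + n"] t0[of m] by (simp add: sum.delta)
    finally show "taylor_coeff a b ((S ^^ n) x) m = taylor_coeff a b y m" by (simp add: t_def)
  qed
  moreover have "(S ^^ m) x = (\<lambda>_. 0)" if "m \<ge> Suc (n + K)" for m
    by (rule S_power_eq_zero[OF _ that]) (auto simp: tx)
  ultimately show ?thesis using n(1) x(1) Nx by blast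
qed

text \<open>The hypercyclic vector is a series of small preimages under rapidly increasing powers of the
  operator; each target occurs infinitely often in the enumeration.\<close>

lemma dense_orbit_coords:
  assumes unb: "\<And>C. \<exists>n. norm (W n) > C * N (monomial_coords a b n)"
  shows "\<exists>x\<in>E. \<forall>f\<in>E. \<forall>e>0. \<exists>n. N (\<lambda>i. f i - (S ^^ n) x i) < e"
proof -
  obtain y :: "nat \<Rightarrow> nat \<Rightarrow> complex" where y: "\<And>i. \<exists>K. \<forall>n\<ge>K. y i n = 0"
    and dense: "\<And>x e. x \<in> E \<Longrightarrow> e > 0 \<Longrightarrow> \<exists>i. y i \<in> E \<and> N (\<lambda>n. x n - y i n) < e"
    using countable_dense by metis
  define Y where "Y k = y (fst (prod_decode k))" for k
  define P where "P = (\<lambda>(k::nat) (z, n::nat). z \<in> E \<and> (\<exists>L. \<forall>m\<ge>L. (S ^^ m) z = (\<lambda>_. 0)))"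
  \<comment> \<open>A state is a partial sum with its exponent. The new exponent sends the new
    partial sum exactly onto the target, and the increment stays below (1/2)^k even after n further
    applications of \<open>S\<close>, n being the previous exponent.\<close>
  define Q where "Q = (\<lambda>(k::nat) (z, n::nat) (z', n'). n \<le> n' \<and> (S ^^ n') z' = Y k \<and>
      N (\<lambda>i. z' i - z i) \<le> (1/2)^k / op_bound ^ n)"
  have "\<exists>s. \<forall>k. P k (s k) \<and> Q k (s k) (s (Suc k))"
  proof (rule dependent_nat_choice)
    show "\<exists>s. P 0 s"
      by (intro exI[of _ "(\<lambda>_. 0, 0)"]) (auto simp: P_def zero taylor_coeff_def intro!: exI[of _ 0] S_power_eq_zero[of 0])
  next
    fix s k assume s: "P k s"
    obtain z n where zn: "s = (z, n)" by (cases s)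
    obtain L where z: "z \<in> E" and L: "\<And>m. m \<ge> L \<Longrightarrow> (S ^^ m) z = (\<lambda>_. 0)" using s zn by (auto simp: P_def)
    have pos: "(1/2)^k / op_bound ^ n > 0" using op_bound_ge_1 by simp
    obtain K where K: "\<And>n. n \<ge> K \<Longrightarrow> Y k n = 0" using y unfolding Y_def by blast
    \<comment> \<open>Taking n' \<ge> L annihilates the old partial sum, so only the new summand
      contributes to the target.\<close>
    obtain n' x L' where n': "n' \<ge> max L n" and x: "x \<in> E" "N x < (1/2)^k / op_bound ^ n" "(S ^^ n') x = Y k"
      and L': "\<And>m. m \<ge> L' \<Longrightarrow> (S ^^ m) x = (\<lambda>_. 0)"
      using small_preimage[where y = "Y k" and K = K and ?n0.0 = "max L n", OF unb pos K] by blast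
    let ?z = "\<lambda>i. z i + x i"
    have "P (Suc k) (?z, n')"
      using add[OF z x(1)] L L' by (auto simp: P_def S_power_add intro!: exI[of _ "max L L'"])
    moreover have "Q k s (?z, n')"
      using n' x L[of n'] by (auto simp: Q_def zn S_power_add)
    ultimately show "\<exists>s'. P (Suc k) s' \<and> Q k s s'" by blast
  qed
  then obtain s where s: "\<And>k. P k (s k)" "\<And>k. Q k (s k) (s (Suc k))" by blast
  define z where "z k = fst (s k)" for k
  define n where "n k = snd (s k)" for k
  have zE: "z k \<in> E" for k using s(1)[of k] by (auto simp: P_def z_def split: prod.splits)
  have Q: "n k \<le> n (Suc k)" "(S ^^ n (Suc k)) (z (Suc k)) = Y k"
      "N (\<lambda>i. z (Suc k) i - z k i) \<le> (1/2)^k / op_bound ^ n k" for k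
    using s(2)[of k] by (auto simp: Q_def z_def n_def split: prod.splits)
  have n_mono: "n k \<le> n l" if "k \<le> l" for k l using Q(1) that by (simp add: lift_Suc_mono_le)
  have step: "N (\<lambda>i. z (Suc k) i - z k i) \<le> (1/2)^k" for k
  proof -
    have "(1/2)^k / op_bound ^ n k \<le> (1/2)^k / 1"
      using op_bound_ge_1 by (intro divide_left_mono) (auto simp: one_le_power)
    then show ?thesis using Q(3)[of k] by simp
  qed
  obtain x where x: "x \<in> E" "\<And>k. N (\<lambda>i. x i - z k i) \<le> 2 * (1/2)^k"
    using cauchy_limit[OF zE step] by blast
  have approx: "N (\<lambda>i. (S ^^ n (Suc k)) x i - Y k i) \<le> 3 * (1/2)^k" for k
  proof -
    let ?n = "n (Suc k)" and ?k = "Suc k"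
    \<comment> \<open>All later increments are divided by powers of \<open>op_bound\<close> with
      exponents at least \<open>?n\<close>, so that the common divisor can be pulled out.\<close>
    have tele: "N (\<lambda>i. z (?k + j) i - z ?k i) \<le> (2 * (1/2)^?k - 2 * (1/2)^(?k+j)) / op_bound ^ ?n" for j
    proof (induction j)
      case 0
      then show ?case using zero by simp
    next
      case (Suc j)
      have "N (\<lambda>i. z (?k + Suc j) i - z ?k i) \<le> N (\<lambda>i. z (Suc (?k+j)) i - z (?k+j) i) + N (\<lambda>i. z (?k+j) i - z ?k i)"
        using diff_triangle[OF zE zE zE] by simp
      also have "N (\<lambda>i. z (Suc (?k+j)) i - z (?k+j) i) \<le> (1/2)^(?k+j) / op_bound ^ n (?k+j)" by (rule Q(3))
      also have "\<dots> \<le> (1/2)^(?k+j) / op_bound ^ ?n"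
        using op_bound_ge_1 n_mono[of ?k "?k + j"]
        by (intro divide_left_mono power_increasing mult_pos_pos) auto
      finally show ?case using Suc by (simp add: add_divide_distrib diff_divide_distrib)
    qed
    \<comment> \<open>The rate from \<open>cauchy_limit\<close> has no divisor
      \<open>op_bound ^ ?n\<close>; a sufficiently late partial sum makes up for it.\<close>
    have "\<exists>l\<ge>?k. 2 * (1/2::real)^l < (1/2)^?k / op_bound ^ ?n"
    proof -
      have "(\<lambda>k. 2 * (1/2::real)^k) \<longlonglongrightarrow> 0"
        using tendsto_mult_right_zero[OF LIMSEQ_power_zero[of "1/2::real"]] by simp
      moreover have "(1/2)^?k / op_bound ^ ?n > 0" using op_bound_ge_1 by simp
      ultimately have "\<forall>\<^sub>F l in sequentially. 2 * (1/2::real)^l < (1/2)^?k / op_bound ^ ?n"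
        by (rule order_tendstoD(2))
      then show ?thesis unfolding eventually_sequentially by (meson le_cases order_refl)
    qed
    then obtain j where j: "2 * (1/2::real)^(?k + j) < (1/2)^?k / op_bound ^ ?n"
      by (metis le_iff_add)
    have "N (\<lambda>i. x i - z ?k i) \<le> N (\<lambda>i. x i - z (?k+j) i) + N (\<lambda>i. z (?k+j) i - z ?k i)"
      using diff_triangle[OF x(1) zE zE] by simp
    also have "\<dots> \<le> (1/2)^?k / op_bound ^ ?n + 2 * (1/2)^?k / op_bound ^ ?n"
    proof (rule add_mono)
      show "N (\<lambda>i. x i - z (?k+j) i) \<le> (1/2)^?k / op_bound ^ ?n" using x(2)[of "?k+j"] j by linarith
      have "(2 * (1/2)^?k - 2 * (1/2)^(?k+j)) / op_bound ^ ?n \<le> 2 * (1/2)^?k / op_bound ^ ?n"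
        using op_bound_ge_1 by (intro divide_right_mono) auto
      then show "N (\<lambda>i. z (?k+j) i - z ?k i) \<le> 2 * (1/2)^?k / op_bound ^ ?n" using tele[of j] by linarith
    qed
    finally have d: "N (\<lambda>i. x i - z ?k i) \<le> 3 * (1/2)^?k / op_bound ^ ?n" by (simp add: add_divide_distrib[symmetric])
    have "N (\<lambda>i. (S ^^ ?n) x i - Y k i) = N ((S ^^ ?n) (\<lambda>i. x i - z ?k i))"
      by (simp add: S_power_diff Q(2))
    also have "\<dots> \<le> op_bound ^ ?n * N (\<lambda>i. x i - z ?k i)"
      by (rule S_power_bound) (use diff[OF x(1) zE] in blast)
    also have "\<dots> \<le> op_bound ^ ?n * (3 * (1/2)^?k / op_bound ^ ?n)"
      using op_bound_ge_1 d by (intro mult_left_mono) auto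
    also have "\<dots> = 3 * (1/2)^?k" using op_bound_ge_1 by simp
    also have "\<dots> \<le> 3 * (1/2)^k" by simp
    finally show ?thesis .
  qed
  have "\<exists>n. N (\<lambda>i. f i - (S ^^ n) x i) < e" if f: "f \<in> E" and e: "e > 0" for f e
  proof -
    obtain i where i: "y i \<in> E" "N (\<lambda>n. f n - y i n) < e/2" using dense[OF f, of "e/2"] e by auto
    have "(\<lambda>k. 3 * (1/2::real)^k) \<longlonglongrightarrow> 0"
      using tendsto_mult_right_zero[OF LIMSEQ_power_zero[of "1/2::real"]] by simp
    then have "\<forall>\<^sub>F k in sequentially. 3 * (1/2::real)^k < e/2" by (rule order_tendstoD(2)) (use e in simp)
    then obtain k0 where k0: "\<And>k. k \<ge> k0 \<Longrightarrow> 3 * (1/2::real)^k < e/2" by (auto simp: eventually_sequentially)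
    \<comment> \<open>The pairing code is at least its second component, so this stage has target
      \<open>y i\<close> and an error below e/2.\<close>
    define k where "k = prod_encode (i, k0)"
    have "k \<ge> k0" by (simp add: k_def le_prod_encode_2)
    then have kb: "3 * (1/2::real)^k < e/2" by (rule k0)
    have Yk: "Y k = y i" by (simp add: Y_def k_def)
    have SE: "(S ^^ n (Suc k)) x \<in> E" by (rule S_power_closed[OF x(1)])
    have "N (\<lambda>j. f j - (S ^^ n (Suc k)) x j) \<le> N (\<lambda>j. f j - y i j) + N (\<lambda>j. y i j - (S ^^ n (Suc k)) x j)"
      by (rule diff_triangle[OF f i(1) SE])
    also have "N (\<lambda>j. y i j - (S ^^ n (Suc k)) x j) = N (\<lambda>j. (S ^^ n (Suc k)) x j - y i j)"
      by (rule diff_commute[OF i(1) SE])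
    finally show ?thesis using approx[of k] kb i(2) unfolding Yk by (intro exI[of _ "n (Suc k)"]) linarith
  qed
  then show ?thesis using x(1) by blast
qed

end

section \<open>Transfer to analytic functions\<close>

text \<open>\<open>radius\<close> is the common consequence of the three domain conditions. Together
  with the boundedness of coordinates it gives absolute convergence inside the disc.\<close>

locale function_space = shift_space +
  assumes radius: "0 \<le> r \<Longrightarrow> r < 1 \<Longrightarrow> summable (\<lambda>n. (norm (a n) + norm (b n)) * r ^ n)"
begin

abbreviation "X \<equiv> ab_space E a b"
abbreviation "NX f \<equiv> N (ab_coords E a b f)"

definition synth :: "(nat \<Rightarrow> complex) \<Rightarrow> complex \<Rightarrow> complex" where
  "synth l z = (if z \<in> ball 0 1 then \<Sum>n. l n * basis_fun a b n z else 0)"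

text \<open>Coordinates are bounded by \<open>N l\<close>, so the a-part and the b-part converge
  absolutely on their own; moving the b-part by one index regroups the expansion in f_n into the
  Taylor series.\<close>

lemma synth_sums:
  assumes l: "l \<in> E" and z: "z \<in> ball 0 1"
  shows "(\<lambda>n. l n * basis_fun a b n z) sums synth l z"
    and "(\<lambda>n. taylor_coeff a b l n * z ^ n) sums synth l z"
proof -
  have dom: "summable (\<lambda>n. N l * ((norm (a n) + norm (b n)) * norm z ^ n))"
    using radius[of "norm z"] z by (intro summable_mult) auto
  have le: "norm (l n) \<le> N l" for n by (rule coord[OF l])
  have "summable (\<lambda>n. l n * a n * z ^ n)"
    by (rule summable_comparison_test'[OF dom, of 0])
      (auto simp: norm_mult norm_power mult.assoc intro!: mult_mono le N_nonneg l mult_right_mono)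
  then obtain sa where sa: "(\<lambda>n. l n * a n * z ^ n) sums sa" by (auto simp: summable_def)
  have "summable (\<lambda>n. l n * b n * z ^ n)"
    by (rule summable_comparison_test'[OF dom, of 0])
      (auto simp: norm_mult norm_power mult.assoc intro!: mult_mono le N_nonneg l mult_right_mono)
  then obtain sb where sb: "(\<lambda>n. l n * b n * z ^ n * z) sums sb"
    using summable_mult2 unfolding summable_def by blast
  have "(\<lambda>n. l n * a n * z ^ n + l n * b n * z ^ n * z) sums (sa + sb)" by (rule sums_add[OF sa sb])
  then have 1: "(\<lambda>n. l n * basis_fun a b n z) sums (sa + sb)"
    by (simp add: basis_fun_def algebra_simps)
  then have s: "synth l z = sa + sb" using z by (simp add: synth_def sums_iff)
  show "(\<lambda>n. l n * basis_fun a b n z) sums synth l z" using 1 s by simp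
  have "(\<lambda>n. if n = 0 then 0 else l (n - 1) * b (n - 1) * z ^ n) sums sb"
    using sums_Suc[of "\<lambda>n. if n = 0 then 0 else l (n - 1) * b (n - 1) * z ^ n" sb] sb by (simp add: mult_ac)
  from sums_add[OF sa this] show "(\<lambda>n. taylor_coeff a b l n * z ^ n) sums synth l z"
    unfolding s taylor_coeff_def by (rule sums_cong[THEN iffD1, rotated]) (auto simp: algebra_simps)
qed

lemma fps_expansion_synth:
  assumes l: "l \<in> E"
  shows "synth l has_fps_expansion Abs_fps (taylor_coeff a b l)"
proof (rule has_fps_expansionI)
  have "\<forall>\<^sub>F u in nhds 0. u \<in> ball (0::complex) 1" by (intro eventually_nhds_in_open) auto
  then show "\<forall>\<^sub>F u in nhds 0. (\<lambda>n. fps_nth (Abs_fps (taylor_coeff a b l)) n * u ^ n) sums synth l u"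
    by eventually_elim (simp add: synth_sums(2)[OF l])
qed

lemma eval_fps_synth:
  assumes "l \<in> E" "z \<in> ball 0 1"
  shows "eval_fps (Abs_fps (taylor_coeff a b l)) z = synth l z"
  using synth_sums(2)[OF assms] by (simp add: eval_fps_def sums_iff)

lemma synth_holomorphic:
  assumes l: "l \<in> E"
  shows "synth l holomorphic_on ball 0 1"
proof -
  have "fps_conv_radius (Abs_fps (taylor_coeff a b l)) \<ge> 1"
    unfolding fps_conv_radius_def
  proof (rule conv_radius_geI_ex')
    fix r :: real assume "0 < r" "ereal r < 1"
    then show "summable (\<lambda>n. fps_nth (Abs_fps (taylor_coeff a b l)) n * of_real r ^ n)"
      using synth_sums(2)[OF l, of "of_real r"] by (auto simp: sums_iff)
  qed
  then have "ball 0 1 \<subseteq> eball 0 (fps_conv_radius (Abs_fps (taylor_coeff a b l)))"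
    by (intro ball_eball_mono) (simp add: one_ereal_def)
  then have "eval_fps (Abs_fps (taylor_coeff a b l)) holomorphic_on ball 0 1"
    by (rule holomorphic_on_eval_fps)
  then show ?thesis by (rule holomorphic_transform) (rule eval_fps_synth[OF l])
qed

lemma synth_closed: "l \<in> E \<Longrightarrow> synth l \<in> X"
  unfolding ab_space_def represents_def mem_Collect_eq
  using synth_holomorphic synth_sums(1) by (intro conjI bexI[of _ l]) (auto simp: synth_def[of _ z for z])

text \<open>Uniqueness of power series combined with the bidiagonal recursion; this is what makes
  the description in \<open>ab_coords\<close> proper.\<close>

lemma synth_inject:
  assumes "l \<in> E" "l' \<in> E" "synth l = synth l'"
  shows "l = l'"
proof (rule taylor_coeff_inject[where a = a and b = b, OF a_nz])
  have "Abs_fps (taylor_coeff a b l) = Abs_fps (taylor_coeff a b l')"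
    using fps_expansion_eqI[OF fps_expansion_synth[OF assms(1)]]
      fps_expansion_eqI[OF fps_expansion_synth[OF assms(2)]] assms(3) by simp
  then show "taylor_coeff a b l n = taylor_coeff a b l' n" for n
    by (metis fps_nth_Abs_fps)
qed

lemma represents_imp_synth:
  assumes "f \<in> X" "represents a b l f"
  shows "f = synth l"
proof
  fix z show "f z = synth l z"
    using assms by (cases "z \<in> ball 0 1") (auto simp: ab_space_def represents_def synth_def sums_iff)
qed

lemma space_cases:
  assumes "f \<in> X"
  obtains l where "l \<in> E" "f = synth l"
  using assms represents_imp_synth[OF assms] by (auto simp: ab_space_def)

lemma coords_synth: "l \<in> E \<Longrightarrow> ab_coords E a b (synth l) = l"
  unfolding ab_coords_def
proof (rule the_equality)
  assume l: "l \<in> E"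
  then show "l \<in> E \<and> represents a b l (synth l)" using synth_sums(1) by (auto simp: represents_def)
  show "l' = l" if "l' \<in> E \<and> represents a b l' (synth l)" for l'
    using that l synth_inject represents_imp_synth[OF synth_closed[OF l]] by metis
qed

lemma synth_add:
  assumes "l \<in> E" "l' \<in> E"
  shows "synth (\<lambda>n. l n + l' n) = (\<lambda>z. synth l z + synth l' z)"
proof
  fix z show "synth (\<lambda>n. l n + l' n) z = synth l z + synth l' z"
    using sums_add[OF synth_sums(1)[OF assms(1), of z] synth_sums(1)[OF assms(2), of z]]
    by (cases "z \<in> ball 0 1") (auto simp: synth_def sums_iff distrib_right)
qed

lemma synth_scale:
  assumes "l \<in> E"
  shows "synth (\<lambda>n. c * l n) = (\<lambda>z. c * synth l z)"
proof
  fix z show "synth (\<lambda>n. c * l n) z = c * synth l z"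
    using sums_mult[OF synth_sums(1)[OF assms, of z], of c]
    by (cases "z \<in> ball 0 1") (auto simp: synth_def sums_iff mult.assoc)
qed

lemma synth_diff:
  assumes "l \<in> E" "l' \<in> E"
  shows "synth (\<lambda>n. l n - l' n) = (\<lambda>z. synth l z - synth l' z)"
  using synth_add[OF assms(1), of "\<lambda>n. -1 * l' n"] synth_scale[OF assms(2), of "-1"] scale[OF assms(2), of "-1"]
  by simp

lemma backward_shift_synth:
  assumes l: "l \<in> E"
  shows "backward_shift w (synth l) = synth (S l)"
proof
  fix z
  have "Abs_fps (\<lambda>n. w (n + 1) * fps_nth (fps_expansion (synth l) 0) (n + 1)) = Abs_fps (taylor_coeff a b (S l))"
    using fps_expansion_eqI[OF fps_expansion_synth[OF l]] taylor_coeff_coord_shift[where a = a, OF a_nz]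
    by (simp add: fps_eq_iff)
  then show "backward_shift w (synth l) z = synth (S l) z"
    using eval_fps_synth[OF S_closed[OF l], of z] by (auto simp: backward_shift_def synth_def)
qed

lemma backward_shift_power_synth: "l \<in> E \<Longrightarrow> (backward_shift w ^^ n) (synth l) = synth ((S ^^ n) l)"
  by (induction n) (simp_all add: backward_shift_synth S_power_closed)

lemma bounded_backward_shift: "bounded_operator_on X NX (backward_shift w)"
  unfolding bounded_operator_on_def
proof (intro conjI ballI allI)
  fix f assume "f \<in> X"
  then obtain l where l: "l \<in> E" "f = synth l" by (rule space_cases)
  show "backward_shift w f \<in> X" using l by (simp add: backward_shift_synth synth_closed S_closed)
  show "backward_shift w (\<lambda>z. k * f z) = (\<lambda>z. k * backward_shift w f z)" for k
    using l scale[OF l(1), of k] S_closed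
    by (simp add: synth_scale[symmetric] backward_shift_synth coord_shift_scale)
  fix g assume "g \<in> X"
  then obtain l' where l': "l' \<in> E" "g = synth l'" by (rule space_cases)
  show "backward_shift w (\<lambda>z. f z + g z) = (\<lambda>z. backward_shift w f z + backward_shift w g z)"
    using l l' add[OF l(1) l'(1)] S_closed
    by (simp add: synth_add[symmetric] backward_shift_synth coord_shift_add)
next
  show "\<exists>C. \<forall>f\<in>X. NX (backward_shift w f) \<le> C * NX f"
  proof (intro exI ballI)
    fix f assume "f \<in> X"
    then obtain l where l: "l \<in> E" "f = synth l" by (rule space_cases)
    then show "NX (backward_shift w f) \<le> op_bound * NX f"
      by (simp add: backward_shift_synth coords_synth S_closed S_bound)
  qed
qed

section \<open>Hypercyclicity and necessary growth on the function space\<close>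

theorem hypercyclic_backward_shift:
  assumes unb: "\<And>C. \<exists>n. norm (W n) > C * N (monomial_coords a b n)"
  shows "hypercyclic_on X NX (backward_shift w)"
proof -
  obtain x where x: "x \<in> E" and dense: "\<And>f e. f \<in> E \<Longrightarrow> e > 0 \<Longrightarrow> \<exists>n. N (\<lambda>i. f i - (S ^^ n) x i) < e"
    using dense_orbit_coords[OF unb] by blast
  have orbit: "(backward_shift w ^^ n) (synth x) = synth ((S ^^ n) x)" for n
    by (rule backward_shift_power_synth[OF x])
  have "norm_dense_in X NX (range (\<lambda>n. (backward_shift w ^^ n) (synth x)))"
    unfolding norm_dense_in_def orbit
  proof (intro conjI ballI allI impI)
    show "range (\<lambda>n. synth ((S ^^ n) x)) \<subseteq> X" using synth_closed S_power_closed x by auto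
    fix f and e :: real assume "f \<in> X" and e: "e > 0"
    then obtain l where l: "l \<in> E" "f = synth l" using space_cases by blast
    obtain n where n: "N (\<lambda>i. l i - (S ^^ n) x i) < e" using dense[OF l(1) e] by blast
    have SE: "(S ^^ n) x \<in> E" by (rule S_power_closed[OF x])
    have "NX (\<lambda>z. f z - synth ((S ^^ n) x) z) < e"
      unfolding l(2) synth_diff[OF l(1) SE, symmetric] using n diff[OF l(1) SE] by (simp add: coords_synth)
    then show "\<exists>g\<in>range (\<lambda>n. synth ((S ^^ n) x)). NX (\<lambda>z. f z - g z) < e" by blast
  qed
  then show ?thesis
    unfolding hypercyclic_on_def using bounded_backward_shift synth_closed[OF x] by blast
qed

text \<open>The functional \<open>f \<mapsto> f(0)\<close> is continuous and unbounded on \<open>X\<close>, while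
  \<open>(B\<^sub>w\<^sup>n f)(0)\<close> is \<open>w\<^sub>1 \<cdots> w\<^sub>n\<close> times the \<open>n\<close>-th Taylor coefficient of \<open>f\<close>.\<close>

theorem dense_iterates_imp_unbounded:
  assumes K: "norm_bounded_in X NX K" and dense: "norm_dense_in X NX (\<Union>n. (backward_shift w ^^ n) ` K)"
  shows "\<exists>n\<ge>1. norm (W n) * (norm (a n) + norm (b (n - 1))) > C"
proof (rule ccontr)
  assume "\<not> ?thesis"
  then have C: "norm (W n) * (norm (a n) + norm (b (n - 1))) \<le> C" if "n \<ge> 1" for n
    using that by (meson not_le)
  obtain D0 where D0: "\<And>f. f \<in> K \<Longrightarrow> NX f \<le> D0" and KX: "K \<subseteq> X"
    using K by (auto simp: norm_bounded_in_def)
  define D where "D = max D0 0"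
  have C0: "C \<ge> 0" using C[of 1] by (meson le_refl mult_nonneg_nonneg norm_ge_zero add_nonneg_nonneg order_trans)
  \<comment> \<open>The value at 0 is \<open>a 0\<close> times the coordinate 0, hence the division.
    The summand D * C covers n \<ge> 1, the other one n = 0.\<close>
  define R where "R = (D * C + D * norm (a 0)) / norm (a 0)"
  have a0: "norm (a 0) > 0" using a_nz by simp
  have small: "norm ((S ^^ n) l 0) \<le> R" if l: "l \<in> E" "N l \<le> D" for l n
  proof -
    have "norm ((S ^^ n) l 0) * norm (a 0) = norm (W n) * norm (taylor_coeff a b l n)"
      using arg_cong[OF taylor_coeff_S_power[of n l 0], of norm]
      by (simp add: norm_mult) (simp add: taylor_coeff_def norm_mult)
    also have "\<dots> \<le> D * C + D * norm (a 0)"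
    proof (cases "n = 0")
      case True
      have "norm (l 0) * norm (a 0) \<le> D * norm (a 0)"
        using coord[OF l(1), of 0] l(2) by (intro mult_right_mono) auto
      moreover have "D * C \<ge> 0" using C0 by (simp add: D_def)
      ultimately show ?thesis using True by (simp add: taylor_coeff_def norm_mult)
    next
      case False
      have "norm (taylor_coeff a b l n) \<le> D * (norm (a n) + norm (b (n - 1)))"
        using coord[OF l(1)] l(2) by (intro taylor_coeff_bound) (meson order_trans)
      then have "norm (W n) * norm (taylor_coeff a b l n) \<le> norm (W n) * (D * (norm (a n) + norm (b (n - 1))))"
        by (intro mult_left_mono) auto
      also have "\<dots> = D * (norm (W n) * (norm (a n) + norm (b (n - 1))))" by simp
      also have "\<dots> \<le> D * C" using C[of n] False by (intro mult_left_mono) (auto simp: D_def)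
      also have "\<dots> \<le> D * C + D * norm (a 0)" by (simp add: D_def)
      finally show ?thesis .
    qed
    finally show ?thesis using a0 by (simp add: R_def field_simps)
  qed
  have R0: "R \<ge> 0" using C0 by (simp add: R_def D_def)
  \<comment> \<open>A multiple of f_0 whose coordinate 0 has modulus R + 2; no element within
    distance 1 can have coordinate 0 bounded by R.\<close>
  define g :: "nat \<Rightarrow> complex" where "g = (\<lambda>n. complex_of_real (R + 2) * (if n = 0 then 1 else 0))"
  have g: "g \<in> E" unfolding g_def using scale[OF unit(1)[of 0]] by blast
  from dense have "\<forall>f\<in>X. \<forall>e>0. \<exists>h\<in>(\<Union>n. (backward_shift w ^^ n) ` K). NX (\<lambda>z. f z - h z) < e"
    unfolding norm_dense_in_def by (rule conjunct2)
  from this[rule_format, OF synth_closed[OF g] zero_less_one]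
  obtain h where h: "h \<in> (\<Union>n. (backward_shift w ^^ n) ` K)" and hd: "NX (\<lambda>z. synth g z - h z) < 1"
    by (rule bexE)
  obtain n f where f: "f \<in> K" "h = (backward_shift w ^^ n) f" using h by blast
  obtain l where l: "l \<in> E" "f = synth l" using space_cases f KX by blast
  have Nl: "N l \<le> D" using D0[OF f(1)] l by (simp add: coords_synth D_def)
  have h': "h = synth ((S ^^ n) l)" using f l backward_shift_power_synth by simp
  note SE = S_power_closed[OF l(1), of n]
  have "N (\<lambda>i. g i - (S ^^ n) l i) < 1"
    using hd diff[OF g SE] unfolding h' synth_diff[OF g SE, symmetric] by (simp add: coords_synth)
  then have "norm (g 0 - (S ^^ n) l 0) < 1"
    using coord[of "\<lambda>i. g i - (S ^^ n) l i" 0] diff[OF g SE] by force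
  moreover have "norm (g 0) = R + 2" using R0 by (simp add: g_def flip: of_real_add)
  ultimately show False using small[OF l(1) Nl, of n] norm_triangle_ineq2[of "g 0" "(S ^^ n) l 0"] by linarith
qed

lemma hypercyclic_imp_bounded_dense:
  assumes "hypercyclic_on X NX (backward_shift w)"
  obtains K where "norm_bounded_in X NX K" "norm_dense_in X NX (\<Union>n. (backward_shift w ^^ n) ` K)"
proof -
  obtain f where f: "f \<in> X" "norm_dense_in X NX (range (\<lambda>n. (backward_shift w ^^ n) f))"
    using assms by (auto simp: hypercyclic_on_def)
  have "(\<Union>n. (backward_shift w ^^ n) ` {f}) = range (\<lambda>n. (backward_shift w ^^ n) f)" by auto
  then show ?thesis using that[of "{f}"] f by (auto simp: norm_bounded_in_def)
qed

section \<open>From growth of quotients to hypercyclicity\<close>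

lemma ratio_prod_closed: "ratio_prod a b n \<in> E"
  by (rule summable_in_space[OF ratio_prod_summable])

text \<open>Up to signs, the coordinates of z^n are the ratios shifted right by n and divided by
  \<open>a n\<close>. This links the size of z^n to the denominators of the two sufficient
  conditions.\<close>

lemma N_monomial_le: "N (monomial_coords a b n) \<le> N (ratio_prod a b n) / norm (a n)"
proof -
  note r = right_shift[OF ratio_prod_closed[of n], of n]
  let ?x = "\<lambda>m. (1 / a n) * (if m < n then 0 else ratio_prod a b n (m - n))"
  have s: "?x \<in> E \<and> N ?x \<le> norm (1 / a n) * N (\<lambda>m. if m < n then 0 else ratio_prod a b n (m - n))"
    by (rule scale) (use r in blast)
  have "norm (1 / a n) * N (\<lambda>m. if m < n then 0 else ratio_prod a b n (m - n)) \<le> norm (1 / a n) * N (ratio_prod a b n)"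
    using r by (intro mult_left_mono) auto
  moreover have "N (monomial_coords a b n) \<le> N ?x"
    using solid[of ?x "monomial_coords a b n"] s
    by (auto simp: monomial_coords_def norm_mult norm_divide norm_power)
  ultimately show ?thesis using s by (simp add: norm_divide)
qed

lemma hypercyclic_if_unbounded_ratio:
  assumes "\<And>C. C \<ge> 0 \<Longrightarrow> \<exists>n. norm (W n * a n) > C * N (ratio_prod a b n)"
  shows "hypercyclic_on X NX (backward_shift w)"
proof (rule hypercyclic_backward_shift)
  fix C :: real
  define C' where "C' = max C 0"
  obtain n where n: "norm (W n * a n) > C' * N (ratio_prod a b n)" using assms[of C'] by (auto simp: C'_def)
  have a: "norm (a n) > 0" using a_nz by simp
  have "C * N (monomial_coords a b n) \<le> C' * N (monomial_coords a b n)"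
    by (intro mult_right_mono N_nonneg monomial_closed) (simp add: C'_def)
  also have "\<dots> \<le> C' * (N (ratio_prod a b n) / norm (a n))"
    by (intro mult_left_mono N_monomial_le) (simp add: C'_def)
  also have "\<dots> < norm (W n)" using n a by (simp add: norm_mult field_simps)
  finally show "\<exists>n. norm (W n) > C * N (monomial_coords a b n)" by blast
qed

lemma hypercyclic_if_SUP_quotient:
  assumes den: "\<And>n. ennreal (N (ratio_prod a b n)) \<le> den n"
    and sup: "(SUP n\<in>{1..}. ennreal (norm (W n * a n)) / den n) = \<infinity>"
  shows "hypercyclic_on X NX (backward_shift w)"
proof (rule hypercyclic_if_unbounded_ratio)
  fix C :: real assume C: "C \<ge> 0"
  have "ennreal C < (SUP n\<in>{1..}. ennreal (norm (W n * a n)) / den n)" unfolding sup by simp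
  then obtain n where n: "ennreal C < ennreal (norm (W n * a n)) / den n" by (auto simp: less_SUP_iff)
  \<comment> \<open>The empty product gives the coordinate 1 at index 0, so dividing by this norm is
    safe.\<close>
  have N1: "N (ratio_prod a b n) \<ge> 1" using coord[OF ratio_prod_closed[of n], of 0] by simp
  \<comment> \<open>A quotient by infinity would be 0, which cannot exceed
    \<open>ennreal C\<close>.\<close>
  have "den n < top" using n by (cases "den n") auto
  then obtain d where d: "den n = ennreal d" "d \<ge> 0" by (cases "den n") auto
  have Nd: "N (ratio_prod a b n) \<le> d" using den[of n] d by simp
  have "C < norm (W n * a n) / d"
    using n N1 Nd C unfolding d(1) by (subst (asm) divide_ennreal) (auto simp: ennreal_less_iff)
  also have "\<dots> \<le> norm (W n * a n) / N (ratio_prod a b n)"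
    using N1 Nd by (intro divide_left_mono) auto
  finally have "C < norm (W n * a n) / N (ratio_prod a b n)" .
  then show "\<exists>n. norm (W n * a n) > C * N (ratio_prod a b n)"
    using N1 by (intro exI[of _ n]) (simp add: field_simps)
qed

lemma SUP_unbounded_if_dense_iterates:
  assumes "norm_bounded_in X NX K" "norm_dense_in X NX (\<Union>n. (backward_shift w ^^ n) ` K)"
  shows "(SUP n\<in>{1..}. ennreal (norm (W n) * (norm (a n) + norm (b (n - 1))))) = \<infinity>"
proof -
  have "\<exists>n\<in>{1..}. x < ennreal (norm (W n) * (norm (a n) + norm (b (n - 1))))" if x: "x < top" for x :: ennreal
  proof -
    obtain c where c: "x = ennreal c" "c \<ge> 0" using x by (cases x) auto
    then show ?thesis using dense_iterates_imp_unbounded[OF assms, of c] by (auto simp: ennreal_less_iff)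
  qed
  then show ?thesis unfolding infinity_ennreal_def SUP_eq_top_iff by blast
qed

text \<open>Proved as a cycle. A bounded set with dense iterates forces growth of |W_n| (|a_n| +
  |b_(n-1)|), where |b_(n-1)| is at most a constant times |a_n|. Conversely, for n \<ge> n0 the
  ratios are dominated by one geometric sequence, so their norms are bounded uniformly in n and the
  quotient criterion applies.\<close>

lemma limsup_ratio_equivalences:
  assumes limsup: "limsup (\<lambda>n. ereal (norm (b n / a (n + 1)))) < 1"
  shows "(hypercyclic_on X NX (backward_shift w) \<longleftrightarrow> (SUP n\<in>{1..}. ennreal (norm (W n * a n))) = \<infinity>) \<and>
     ((SUP n\<in>{1..}. ennreal (norm (W n * a n))) = \<infinity> \<longleftrightarrow>
        (\<exists>K. norm_bounded_in X NX K \<and> norm_dense_in X NX (\<Union>n. (backward_shift w ^^ n) ` K)))"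
    (is "(?H \<longleftrightarrow> ?U) \<and> (?U \<longleftrightarrow> ?D)")
proof -
  obtain r where r: "limsup (\<lambda>n. ereal (norm (b n / a (n + 1)))) < ereal r" "ereal r < 1"
    using ereal_dense2[OF limsup] by blast
  have "\<forall>\<^sub>F n in sequentially. ereal (norm (b n / a (n + 1))) < ereal r" by (rule Limsup_lessD[OF r(1)])
  then obtain n0 where n0: "\<And>n. n \<ge> n0 \<Longrightarrow> norm (b n / a (n + 1)) < r"
    by (auto simp: eventually_sequentially)
  have r01: "0 < r" "r < 1" using n0[of n0] norm_ge_zero[of "b n0 / a (n0 + 1)"] r(2) by (simp_all del: norm_ge_zero)
  have HD: "?H \<Longrightarrow> ?D" using hypercyclic_imp_bounded_dense by blast
  have DU: "?U" if D: "?D"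
  proof -
    obtain K where K: "norm_bounded_in X NX K" "norm_dense_in X NX (\<Union>n. (backward_shift w ^^ n) ` K)"
      using D by blast
    \<comment> \<open>A bound for all ratios, including the finitely many before \<open>n0\<close>
      that may exceed 1.\<close>
    define L where "L = Max (insert r ((\<lambda>n. norm (b n / a (n + 1))) ` {..<n0}))"
    have L: "norm (b n / a (n + 1)) \<le> L" for n
    proof (cases "n < n0")
      case False
      then have "norm (b n / a (n + 1)) \<le> r" using n0[of n] by simp
      also have "r \<le> L" by (simp add: L_def)
      finally show ?thesis .
    qed (auto simp: L_def)
    have L0: "L \<ge> 0" using L[of 0] norm_ge_zero order_trans by blast
    have bL: "norm (b (n - 1)) \<le> L * norm (a n)" if "n \<ge> 1" for n
      using L[of "n - 1"] that a_nz[of n] by (simp add: norm_divide field_simps)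
    have "\<exists>n\<in>{1..}. x < ennreal (norm (W n * a n))" if x: "x < top" for x :: ennreal
    proof -
      obtain c where c: "x = ennreal c" "c \<ge> 0" using x by (cases x) auto
      obtain n where n: "n \<ge> 1" "norm (W n) * (norm (a n) + norm (b (n - 1))) > c * (1 + L)"
        using dense_iterates_imp_unbounded[OF K] by blast
      have "c * (1 + L) < norm (W n) * (norm (a n) + norm (b (n - 1)))" by (rule n)
      also have "\<dots> \<le> norm (W n) * (norm (a n) + L * norm (a n))"
        using bL[OF n(1)] by (intro mult_left_mono) auto
      also have "\<dots> = norm (W n * a n) * (1 + L)" by (simp add: norm_mult algebra_simps)
      finally have "c < norm (W n * a n)" using L0 by simp
      then show ?thesis using n(1) c by (auto simp: ennreal_less_iff)
    qed
    then show ?U unfolding infinity_ennreal_def SUP_eq_top_iff by blast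
  qed
  have UH: "?H" if U: "?U"
  proof (rule hypercyclic_if_unbounded_ratio)
    fix C :: real assume C: "C \<ge> 0"
    let ?\<rho> = "\<lambda>j. complex_of_real (r ^ j)"
    have \<rho>: "?\<rho> \<in> E" using r01 by (intro summable_in_space) (simp add: norm_power summable_geometric)
    have ratio: "norm (ratio_prod a b n j) \<le> norm (?\<rho> j)" if "n \<ge> n0" for n j
    proof (induction j)
      case (Suc j)
      have "norm (ratio_prod a b n j * (b (n + j) / a (Suc (n + j)))) \<le> norm (?\<rho> j) * r"
        unfolding norm_mult[of "ratio_prod a b n j"] using Suc n0[of "n + j"] that by (intro mult_mono) auto
      then show ?case using r01 by (simp add: ratio_prod_Suc norm_mult norm_power mult.commute)
    qed simp
    have Nr: "N (ratio_prod a b n) \<le> N ?\<rho>" if "n \<ge> n0" for n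
      using solid[OF \<rho> ratio[OF that]] by blast
    \<comment> \<open>Dominating the values below \<open>n0\<close> forces the index found next into
      the range of the geometric bound.\<close>
    define B where "B = Max (insert (C * N ?\<rho>) ((\<lambda>n. norm (W n * a n)) ` {..<n0}))"
    have B: "C * N ?\<rho> \<le> B" "\<And>n. n < n0 \<Longrightarrow> norm (W n * a n) \<le> B"
      by (auto simp: B_def intro!: Max_ge)
    have B0: "B \<ge> 0" using B(1) C N_nonneg[OF \<rho>] by (meson mult_nonneg_nonneg order_trans)
    have "ennreal B < (SUP n\<in>{1..}. ennreal (norm (W n * a n)))" unfolding U by simp
    then obtain n where n: "B < norm (W n * a n)" using B0 by (auto simp: less_SUP_iff ennreal_less_iff)
    then have "n \<ge> n0" using B(2)[of n] by (meson not_le)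
    then have "C * N (ratio_prod a b n) \<le> C * N ?\<rho>" using Nr C by (intro mult_left_mono) auto
    then show "\<exists>n. norm (W n * a n) > C * N (ratio_prod a b n)" using n B(1) by (intro exI[of _ n]) linarith
  qed
  show ?thesis using HD DU UH by blast
qed

end

section \<open>Domain conditions, diagonal bounds and denominators\<close>

text \<open>Abel's lemma: boundedness at the midpoint s of r and 1 gives geometric decay with ratio
  r/s at r.\<close>

lemma summable_if_bounded_larger_radius:
  fixes t :: "nat \<Rightarrow> real"
  assumes t: "\<And>n. t n \<ge> 0" and bd: "\<And>r. 0 \<le> r \<Longrightarrow> r < 1 \<Longrightarrow> bdd_above (range (\<lambda>n. t n * r ^ n))"
    and r: "0 \<le> r" "r < 1"
  shows "summable (\<lambda>n. t n * r ^ n)"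
proof -
  define s where "s = (1 + r) / 2"
  have s: "0 < s" "s < 1" "r < s" using r by (auto simp: s_def)
  obtain K where K: "\<And>n. t n * s ^ n \<le> K" using bd[of s] s by (auto simp: bdd_above_def)
  have "summable (\<lambda>n. K * (r / s) ^ n)" using s r by (intro summable_mult summable_geometric) auto
  then show ?thesis
  proof (rule summable_comparison_test'[of _ 0])
    fix n
    have "t n * r ^ n = (t n * s ^ n) * (r / s) ^ n" using s by (simp add: power_divide)
    also have "\<dots> \<le> K * (r / s) ^ n" using K s r by (intro mult_right_mono) auto
    finally show "norm (t n * r ^ n) \<le> K * (r / s) ^ n" using t r by simp
  qed
qed

text \<open>For p = 1 the condition states boundedness; for p > 1 the terms are q-summable and
  therefore bounded. Absolute summability at r follows by comparison with larger radii.\<close>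

lemma lp_domain_radius:
  assumes p: "p \<ge> 1" and dom: "lp_domain_cond p a b" and r: "0 \<le> r" "r < 1"
  shows "summable (\<lambda>n. (norm (a n) + norm (b n)) * r ^ n)"
proof (rule summable_if_bounded_larger_radius[OF _ _ r])
  fix s :: real assume s: "0 \<le> s" "s < 1"
  then have mem: "complex_of_real s \<in> ball 0 1" by simp
  let ?t = "\<lambda>n. (norm (a n) + norm (b n)) * s ^ n"
  have t0: "?t n \<ge> 0" for n using s by simp
  show "bdd_above (range ?t)"
  proof (cases "p = 1")
    case True
    then have "complex_of_real s \<in> domain2 a b" using dom mem by (simp add: lp_domain_cond_def)
    then show ?thesis using s by (simp add: domain2_def)
  next
    case False
    define q where "q = p / (p - 1)"
    have q: "q > 0" "1 / p + 1 / q = 1" using p False by (auto simp: q_def field_simps)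
    then have "complex_of_real s \<in> domain1 q a b" using dom mem False by (simp add: lp_domain_cond_def)
    then have "summable (\<lambda>n. ?t n powr q)" using s by (simp add: domain1_def)
    then have "Bseq (\<lambda>n. ?t n powr q)"
      by (intro convergent_imp_Bseq) (auto simp: convergent_def dest: summable_LIMSEQ_zero)
    then obtain K where K: "\<And>n. norm (?t n powr q) \<le> K" by (auto simp: Bseq_def)
    have "?t n \<le> K powr (1 / q)" for n
    proof -
      have "?t n = (?t n powr q) powr (1 / q)" using q t0[of n] by (simp add: powr_powr)
      also have "\<dots> \<le> K powr (1 / q)" using K[of n] q by (intro powr_mono2) auto
      finally show ?thesis .
    qed
    then show ?thesis by (auto simp: bdd_above_def)
  qed
qed auto

lemma c0_domain_radius:
  assumes "c0_domain_cond a b" "0 \<le> r" "r < 1"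
  shows "summable (\<lambda>n. (norm (a n) + norm (b n)) * r ^ n)"
proof -
  have "complex_of_real r \<in> domain3 a b" using assms by (simp add: c0_domain_cond_def)
  then show ?thesis using assms by (simp add: domain3_def)
qed

text \<open>The finite supremum controls the superdiagonal and the main diagonal; the m-th term of
  the finite sum controls the lower diagonal of index m + 1.\<close>

lemma shift_bounds_exist:
  fixes a b w :: "nat \<Rightarrow> complex"
  assumes a_nz: "\<And>n. a n \<noteq> 0" and w_nz: "\<And>n. w n \<noteq> 0"
    and sup_fin: "(SUP n\<in>{1..}. max (ennreal (norm (w (n + 1) * a (n + 1) / a n)))
                                   (ennreal (norm (shift_coeff a b w n)))) < \<infinity>"
    and sum_fin: "(\<Sum>m. let n = Suc m in
        max (ennreal (norm (w 1 * (b 0)\<^sup>2 * (\<Prod>k=1..<n. b k) / (\<Prod>k=0..n. a k))))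
            (SUP j\<in>{1..}. ennreal (norm (shift_coeff a b w j * ratio_prod a b j n)))) < \<infinity>"
  obtains M \<alpha> where "shift_bounds a b w M \<alpha>"
proof -
  define s where "s = (SUP n\<in>{1..}. max (ennreal (norm (w (n + 1) * a (n + 1) / a n))) (ennreal (norm (shift_coeff a b w n))))"
  define g where "g m = max (ennreal (norm (w 1 * (b 0)\<^sup>2 * (\<Prod>k=1..<Suc m. b k) / (\<Prod>k=0..Suc m. a k))))
            (SUP j\<in>{1..}. ennreal (norm (shift_coeff a b w j * ratio_prod a b j (Suc m))))" for m
  have s: "s < top" using sup_fin by (simp add: s_def)
  have real_le: "x \<le> enn2real y" if "ennreal x \<le> y" "y < top" "x \<ge> 0" for x y
    using enn2real_mono[OF that(1,2)] that(3) by simp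
  have sb: "norm (w (n + 1) * a (n + 1) / a n) \<le> enn2real s" "norm (shift_coeff a b w n) \<le> enn2real s" if "n \<ge> 1" for n
  proof -
    have "max (ennreal (norm (w (n + 1) * a (n + 1) / a n))) (ennreal (norm (shift_coeff a b w n))) \<le> s"
      unfolding s_def using that by (intro SUP_upper) auto
    then show "norm (w (n + 1) * a (n + 1) / a n) \<le> enn2real s" "norm (shift_coeff a b w n) \<le> enn2real s"
      using s by (auto intro!: real_le)
  qed
  have gs: "(\<Sum>m. g m) < top" using sum_fin by (simp add: g_def Let_def)
  have g: "g m < top" for m by (rule ennreal_suminf_lessD[OF gs])
  have gsum: "summable (\<lambda>m. enn2real (g m))"
    by (rule summable_suminf_not_top) (use gs g in \<open>auto simp: ennreal_enn2real\<close>)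
  \<comment> \<open>The supremum starts at n = 1, so the entries of column 1 on the superdiagonal
    and of column 0 on the main diagonal are adjoined by hand, here and in \<alpha> 0.\<close>
  define M where "M = max (enn2real s) (norm (w 1 * a 1 / a 0))"
  define \<alpha> where "\<alpha> n = (case n of 0 \<Rightarrow> max (enn2real s) (norm (w 1 * b 0 / a 0)) | Suc m \<Rightarrow> enn2real (g m))" for n
  have "shift_bounds a b w M \<alpha>"
  proof
    show "a n \<noteq> 0" "w n \<noteq> 0" for n by fact+
    show "M \<ge> 0" by (simp add: M_def le_max_iff_disj)
    show "norm (w (Suc n) * a (Suc n) / a n) \<le> M" for n
      using sb(1)[of n] by (cases "n = 0") (auto simp: M_def)
    have "summable (\<lambda>n. \<alpha> (Suc n))" using gsum by (simp add: \<alpha>_def)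
    then show "summable \<alpha>" by (simp add: summable_Suc_iff)
    show "norm (lower_coeff a b w k * ratio_prod a b k n) \<le> \<alpha> n" for k n
    proof (cases n)
      case 0
      then show ?thesis using sb(2)[of k] by (cases "k = 0") (auto simp: \<alpha>_def lower_coeff_def)
    next
      case (Suc m)
      have "ennreal (norm (lower_coeff a b w k * ratio_prod a b k n)) \<le> g m"
      proof (cases "k = 0")
        case True
        \<comment> \<open>Column 0 is the first entry of the maximum: one factor b_0 comes from
          \<open>lower_coeff\<close>, the other from the ratio, hence the square.\<close>
        have "(\<Prod>k=0..<Suc m. b k) = b 0 * (\<Prod>k=1..<Suc m. b k)"
          using prod.atLeast_Suc_lessThan[of 0 "Suc m" b] by (simp only: One_nat_def zero_less_Suc)
        moreover have "(\<Prod>k=0..Suc m. a k) = a 0 * (\<Prod>k=1..Suc m. a k)"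
          using prod.atLeast_Suc_atMost[of 0 "Suc m" a] by (simp only: One_nat_def le0)
        moreover have "lower_coeff a b w k * ratio_prod a b k n =
            w 1 * b 0 / a 0 * ((\<Prod>k=0..<Suc m. b k) / (\<Prod>k=1..Suc m. a k))"
          by (simp only: Suc True lower_coeff_def ratio_prod_def add_0 if_True refl)
        ultimately have "lower_coeff a b w k * ratio_prod a b k n =
            w 1 * (b 0)\<^sup>2 * (\<Prod>k=1..<Suc m. b k) / (\<Prod>k=0..Suc m. a k)"
          by (simp only: power2_eq_square times_divide_times_eq mult_ac)
        then show ?thesis by (simp add: g_def)
      next
        case False
        then have "ennreal (norm (shift_coeff a b w k * ratio_prod a b k (Suc m)))
            \<le> (SUP j\<in>{1..}. ennreal (norm (shift_coeff a b w j * ratio_prod a b j (Suc m))))"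
          by (intro SUP_upper) auto
        then show ?thesis using False by (simp add: g_def lower_coeff_def Suc le_max_iff_disj)
      qed
      then show ?thesis using g[of m] by (simp add: \<alpha>_def Suc real_le)
    qed
  qed
  then show ?thesis by (rule that)
qed

text \<open>The summand 1 is the term j = 0 of the norm, an empty product; membership keeps
  \<open>ennreal_powr\<close> in its finite case.\<close>

lemma lp_ratio_norm_eq:
  assumes p: "p \<ge> 1" and mem: "ratio_prod a b n \<in> lp_seqs p"
  shows "ennreal (lp_seq_norm p (ratio_prod a b n)) =
    ennreal_powr (1 + (\<Sum>i. ennreal (norm (ratio_prod a b n (Suc i)) powr p))) (1 / p)"
proof -
  let ?f = "\<lambda>i. norm (ratio_prod a b n i) powr p"
  have s: "summable ?f" using mem by (simp add: lp_seqs_def)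
  then have s': "summable (\<lambda>i. ?f (Suc i))" by (subst summable_Suc_iff)
  have nn: "(\<Sum>i. ?f (Suc i)) \<ge> 0" by (intro suminf_nonneg s') auto
  have "(\<Sum>i. ennreal (?f (Suc i))) = ennreal (\<Sum>i. ?f (Suc i))"
    by (rule suminf_ennreal2) (use s' in auto)
  then have "1 + (\<Sum>i. ennreal (?f (Suc i))) = ennreal (1 + (\<Sum>i. ?f (Suc i)))"
    using nn by (simp add: ennreal_plus flip: ennreal_1)
  also have "1 + (\<Sum>i. ?f (Suc i)) = suminf ?f" using suminf_split_head[OF s] by simp
  finally show ?thesis
    using suminf_nonneg[OF s] by (simp add: ennreal_powr_def lp_seq_norm_def enn2real_ennreal)
qed

lemma c0_ratio_norm_le:
  "ennreal (c0_seq_norm (ratio_prod a b n)) \<le> max 1 (SUP j\<in>{1..}. ennreal (norm (ratio_prod a b n j)))"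
  (is "_ \<le> ?d")
proof (cases "?d = top")
  case False
  then have d: "?d < top" by (simp add: less_top)
  have "norm (ratio_prod a b n j) \<le> enn2real ?d" for j
  proof -
    have "ennreal (norm (ratio_prod a b n j)) \<le> ?d"
    proof (cases "j = 0")
      case False
      then have "ennreal (norm (ratio_prod a b n j)) \<le> (SUP j\<in>{1..}. ennreal (norm (ratio_prod a b n j)))"
        by (intro SUP_upper) auto
      then show ?thesis by (simp add: le_max_iff_disj)
    qed simp
    from enn2real_mono[OF this d] show ?thesis by simp
  qed
  then have "c0_seq_norm (ratio_prod a b n) \<le> enn2real ?d" by (rule c0_seq_norm_le)
  then have "ennreal (c0_seq_norm (ratio_prod a b n)) \<le> ennreal (enn2real ?d)" by (rule ennreal_leI)
  also have "\<dots> = ?d" by (rule ennreal_enn2real[OF d])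
  finally show ?thesis .
qed simp

theorem theorem4p5:
  fixes a b w :: "nat \<Rightarrow> complex"
  assumes a_nz: "\<And>n. a n \<noteq> 0"
    and w_nz: "\<And>n. w n \<noteq> 0"
    and sup_fin: "(SUP n\<in>{1..}. max (ennreal (norm (w (n + 1) * a (n + 1) / a n)))
                                   (ennreal (norm (shift_coeff a b w n)))) < \<infinity>"
    and sum_fin: "(\<Sum>m. let n = Suc m in
        max (ennreal (norm (w 1 * (b 0)\<^sup>2 * (\<Prod>k=1..<n. b k) / (\<Prod>k=0..n. a k))))
            (SUP j\<in>{1..}. ennreal (norm (shift_coeff a b w j * ratio_prod a b j n)))) < \<infinity>"
  shows
    "\<comment> \<open>(i)\<close>
     (\<forall>p\<ge>1. lp_domain_cond p a b \<longrightarrow>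
        (SUP n\<in>{1..}. ennreal (norm ((\<Prod>k=1..n. w k) * a n)) /
           ennreal_powr (1 + (\<Sum>i. ennreal (norm (ratio_prod a b n (Suc i)) powr p))) (1 / p)) = \<infinity>
        \<longrightarrow> hypercyclic_on (lp_ab p a b) (lp_ab_norm p a b) (backward_shift w))
     \<and> \<comment> \<open>(ii)\<close>
     (c0_domain_cond a b \<longrightarrow>
        (SUP n\<in>{1..}. ennreal (norm ((\<Prod>k=1..n. w k) * a n)) /
           max 1 (SUP j\<in>{1..}. ennreal (norm (ratio_prod a b n j)))) = \<infinity>
        \<longrightarrow> hypercyclic_on (c0_ab a b) (c0_ab_norm a b) (backward_shift w))
     \<and> \<comment> \<open>(iii)\<close>
     ((\<exists>p\<ge>1. lp_domain_cond p a b \<and>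
              hypercyclic_on (lp_ab p a b) (lp_ab_norm p a b) (backward_shift w)) \<or>
      (c0_domain_cond a b \<and> hypercyclic_on (c0_ab a b) (c0_ab_norm a b) (backward_shift w))
        \<longrightarrow> (SUP n\<in>{1..}. ennreal (norm (\<Prod>k=1..n. w k) * (norm (a n) + norm (b (n - 1))))) = \<infinity>)
     \<and> \<comment> \<open>(iv)\<close>
     (limsup (\<lambda>n. ereal (norm (b n / a (n + 1)))) < 1 \<longrightarrow>
        (\<forall>X N. (\<exists>p\<ge>1. lp_domain_cond p a b \<and> X = lp_ab p a b \<and> N = lp_ab_norm p a b) \<or>
               (c0_domain_cond a b \<and> X = c0_ab a b \<and> N = c0_ab_norm a b) \<longrightarrow>
          (hypercyclic_on X N (backward_shift w) \<longleftrightarrow>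
             (SUP n\<in>{1..}. ennreal (norm ((\<Prod>k=1..n. w k) * a n))) = \<infinity>) \<and>
          ((SUP n\<in>{1..}. ennreal (norm ((\<Prod>k=1..n. w k) * a n))) = \<infinity> \<longleftrightarrow>
             (\<exists>K. norm_bounded_in X N K \<and>
                  norm_dense_in X N (\<Union>n. (backward_shift w ^^ n) ` K)))))"
proof -
  obtain M \<alpha> where sb: "shift_bounds a b w M \<alpha>"
    using shift_bounds_exist[where a = a and b = b and w = w, OF a_nz w_nz sup_fin sum_fin] by blast
  have lp: "function_space (lp_seqs p) (lp_seq_norm p) a b w M \<alpha>" if "p \<ge> 1" "lp_domain_cond p a b" for p
    using seq_space_lp[OF that(1)] sb lp_domain_radius[OF that]
    by (simp add: function_space_def shift_space_def function_space_axioms_def)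
  have c0: "function_space c0_seqs c0_seq_norm a b w M \<alpha>" if "c0_domain_cond a b"
    using seq_space_c0 sb c0_domain_radius[OF that]
    by (simp add: function_space_def shift_space_def function_space_axioms_def)
  have lpN: "lp_ab_norm p a b = (\<lambda>f. lp_seq_norm p (ab_coords (lp_seqs p) a b f))" for p
    by (simp add: fun_eq_iff lp_ab_norm_def)
  have c0N: "c0_ab_norm a b = (\<lambda>f. c0_seq_norm (ab_coords c0_seqs a b f))"
    by (simp add: fun_eq_iff c0_ab_norm_def)
  note spaces = lp_ab_def c0_ab_def lpN c0N
  have SUP_top: "(SUP n\<in>{1..}. ennreal (norm (\<Prod>k=1..n. w k) * (norm (a n) + norm (b (n - 1))))) = \<infinity>"
    if "function_space E N a b w M \<alpha>"
      and hyp: "hypercyclic_on (ab_space E a b) (\<lambda>f. N (ab_coords E a b f)) (backward_shift w)" for E N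
  proof -
    interpret function_space E N a b w M \<alpha> by fact
    show ?thesis using hypercyclic_imp_bounded_dense[OF hyp] SUP_unbounded_if_dense_iterates by blast
  qed
  show ?thesis
  proof (intro conjI allI impI)
    fix p :: real
    assume p: "p \<ge> 1" "lp_domain_cond p a b"
      and sup: "(SUP n\<in>{1..}. ennreal (norm ((\<Prod>k=1..n. w k) * a n)) /
           ennreal_powr (1 + (\<Sum>i. ennreal (norm (ratio_prod a b n (Suc i)) powr p))) (1 / p)) = \<infinity>"
    interpret function_space "lp_seqs p" "lp_seq_norm p" a b w M \<alpha> by (rule lp[OF p])
    show "hypercyclic_on (lp_ab p a b) (lp_ab_norm p a b) (backward_shift w)"
      unfolding spaces
      by (rule hypercyclic_if_SUP_quotient[OF _ sup])
        (rule eq_refl[OF lp_ratio_norm_eq[OF p(1) ratio_prod_closed]])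
  next
    assume dom: "c0_domain_cond a b"
      and sup: "(SUP n\<in>{1..}. ennreal (norm ((\<Prod>k=1..n. w k) * a n)) /
           max 1 (SUP j\<in>{1..}. ennreal (norm (ratio_prod a b n j)))) = \<infinity>"
    interpret function_space c0_seqs c0_seq_norm a b w M \<alpha> by (rule c0[OF dom])
    show "hypercyclic_on (c0_ab a b) (c0_ab_norm a b) (backward_shift w)"
      unfolding spaces by (rule hypercyclic_if_SUP_quotient[OF c0_ratio_norm_le sup])
  next
    assume "(\<exists>p\<ge>1. lp_domain_cond p a b \<and>
              hypercyclic_on (lp_ab p a b) (lp_ab_norm p a b) (backward_shift w)) \<or>
      (c0_domain_cond a b \<and> hypercyclic_on (c0_ab a b) (c0_ab_norm a b) (backward_shift w))"
    then show "(SUP n\<in>{1..}. ennreal (norm (\<Prod>k=1..n. w k) * (norm (a n) + norm (b (n - 1))))) = \<infinity>"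
      unfolding spaces using SUP_top[OF lp] SUP_top[OF c0] by blast
  next
    fix X N
    assume limsup: "limsup (\<lambda>n. ereal (norm (b n / a (n + 1)))) < 1"
      and XN: "(\<exists>p\<ge>1. lp_domain_cond p a b \<and> X = lp_ab p a b \<and> N = lp_ab_norm p a b) \<or>
               (c0_domain_cond a b \<and> X = c0_ab a b \<and> N = c0_ab_norm a b)"
    \<comment> \<open>Both kinds of spaces become one abstract instance, so a single interpretation
      proves the equivalences.\<close>
    obtain E N' where fs: "function_space E N' a b w M \<alpha>"
      and X: "X = ab_space E a b" and N: "N = (\<lambda>f. N' (ab_coords E a b f))"
      using XN lp c0 unfolding spaces by blast
    interpret function_space E N' a b w M \<alpha> by (rule fs)
    note equivs = limsup_ratio_equivalences[OF limsup]
    show "hypercyclic_on X N (backward_shift w) \<longleftrightarrow>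
             (SUP n\<in>{1..}. ennreal (norm ((\<Prod>k=1..n. w k) * a n))) = \<infinity>"
      unfolding X N using equivs by (rule conjunct1)
    show "(SUP n\<in>{1..}. ennreal (norm ((\<Prod>k=1..n. w k) * a n))) = \<infinity> \<longleftrightarrow>
             (\<exists>K. norm_bounded_in X N K \<and>
                  norm_dense_in X N (\<Union>n. (backward_shift w ^^ n) ` K))"
      unfolding X N using equivs by (rule conjunct2)
  qed
qed

end
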